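(* Let $K$ be an arbitrary field, and let $\alpha, p, l$ and $q_1,\dots,q_l$ be positive integers with $1\le p<q_1<\dots<q_l=\alpha-1$. Put $q:=q_1$ and assume $p\ge \alpha-q$. Let $$\mathcal A=\{0,1,\dots,p,q_1,\dots,q_l,\alpha\},$$ and let $S\subseteq\mathbb N^2$ be the semigroup associated to $\mathcal A$, i.e. generated by the elements $(a,\alpha-a)$, $a\in\mathcal A$. Then $r(S)=\operatorname{reg}K[S]$.
   Context: $\mathbb N$ denotes the set of non-negative integers. $K[S]\subseteq K[t_1,t_2]$ is the affine semigroup ring spanned over $K$ by the monomials $t_1^{u_1}t_2^{u_2}$ with $(u_1,u_2)\in S$, where $S$ contains $0$; it is graded by $\deg(u_1,u_2)=(u_1+u_2)/\alpha$. Let $\mathfrak m$ be the maximal homogeneous ideal of $K[S]$ and $\mathfrak q=(t_1^\alpha,t_2^\alpha)\subseteq K[S]$ (a minimal reduction of $\mathfrak m$). The reduction number is $r(S)=\min\{r\in\mathbb N : \mathfrak m^{r+1}=\mathfrak q\,\mathfrak m^r\}$. The Castelnuovo-Mumford regularity $\operatorname{reg}K[S]$ is the smallest integer $n$ such that the graded pieces of local cohomology satisfy $H^i_{\mathfrak m}(K[S])_{j-i}=0$ for all $i\ge0$ and all $j>n$. *)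

theory Defs
  imports "HOL-Algebra.Ideal_Product" "HOL-Algebra.Coset"
    "HOL-Library.Poly_Mapping" "HOL-Library.Product_Plus"
begin

section \<open>Affine semigroup rings in two variables\<close>

text \<open>
  The Laurent polynomial ring \<open>K[t\<^sub>1, t\<^sub>2, t\<^sub>1\<^sup>-\<^sup>1, t\<^sub>2\<^sup>-\<^sup>1]\<close>, with \<open>Poly_Mapping.single (u\<^sub>1, u\<^sub>2) 1\<close> as the
  monomial with exponents \<open>u\<^sub>1, u\<^sub>2\<close>. It contains \<open>K[S]\<close> and all localizations of \<open>K[S]\<close> at monomials.
\<close>
type_synonym 'k laurent = "(int \<times> int) \<Rightarrow>\<^sub>0 'k"

inductive_set assoc_semigroup :: "nat \<Rightarrow> nat set \<Rightarrow> (nat \<times> nat) set"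
  for \<alpha> :: nat and A :: "nat set" where
    zero: "(0, 0) \<in> assoc_semigroup \<alpha> A"
  | add: "s \<in> assoc_semigroup \<alpha> A \<Longrightarrow> a \<in> A \<Longrightarrow> s + (a, \<alpha> - a) \<in> assoc_semigroup \<alpha> A"

definition semigroup_ring :: "(nat \<times> nat) set \<Rightarrow> 'k::field laurent ring" where
  "semigroup_ring S =
    \<lparr> carrier = {f. Poly_Mapping.keys f \<subseteq> map_prod int int ` S},
      mult = (*), one = 1, zero = 0, add = (+) \<rparr>"

definition generator :: "nat \<Rightarrow> nat \<Rightarrow> 'k::field laurent" where
  "generator \<alpha> a = Poly_Mapping.single (int a, int \<alpha> - int a) 1"

text \<open>Degrees are normalized by \<open>deg (u\<^sub>1, u\<^sub>2) = (u\<^sub>1 + u\<^sub>2) / \<alpha>\<close>.\<close>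
definition homogeneous :: "nat \<Rightarrow> int \<Rightarrow> 'k::field laurent \<Rightarrow> bool" where
  "homogeneous \<alpha> j f \<longleftrightarrow> (\<forall>u \<in> Poly_Mapping.keys f. fst u + snd u = int \<alpha> * j)"


section \<open>Reduction number\<close>

text \<open>\<open>\<mm>\<close> is spanned by the monomials \<open>t\<^sup>s\<close> with \<open>s \<in> S - {0}\<close>, that is, by those of positive degree.\<close>
definition max_homogeneous_ideal :: "'k::field laurent ring \<Rightarrow> 'k laurent set" where
  "max_homogeneous_ideal R = {f \<in> carrier R. Poly_Mapping.lookup f (0, 0) = 0}"

definition reduction_ideal :: "nat \<Rightarrow> 'k::field laurent ring \<Rightarrow> 'k laurent set" where
  "reduction_ideal \<alpha> R =
    Idl\<^bsub>R\<^esub> {Poly_Mapping.single (int \<alpha>, 0) 1, Poly_Mapping.single (0, int \<alpha>) 1}"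

text \<open>Powers of ideals are powers in the multiplicative monoid of ideals.\<close>
definition reduction_number :: "nat \<Rightarrow> 'k::field laurent ring \<Rightarrow> nat" where
  "reduction_number \<alpha> R = (LEAST r.
     max_homogeneous_ideal R [^]\<^bsub>ideals_set R\<^esub> (r + 1)
       = reduction_ideal \<alpha> R \<cdot>\<^bsub>R\<^esub> (max_homogeneous_ideal R [^]\<^bsub>ideals_set R\<^esub> r))"


section \<open>Local cohomology\<close>

text \<open>
  For a subring \<open>R\<close> of an ambient ring and \<open>f \<in> R\<close> a unit of the ambient ring, this is the subring
  of all \<open>r / f\<^sup>n\<close>, that is, the localization \<open>R\<^sub>f\<close>.
\<close>
definition localization :: "'a::comm_ring_1 ring \<Rightarrow> 'a \<Rightarrow> 'a set" where
  "localization R f = {x. \<exists>n. f ^ n * x \<in> carrier R}"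

text \<open>
  The Cech complex of \<open>R\<close> on a finite family \<open>(x\<^sub>a)\<close>, \<open>a \<in> A\<close>, of units of the ambient ring:
  its \<open>i\<close>-th term is the direct sum of the localizations of \<open>R\<close> at the products \<open>x\<^sub>\<sigma>\<close>, \<open>a \<in> \<sigma>\<close>, over the
  subsets \<open>\<sigma>\<close> of \<open>A\<close> with \<open>i\<close> elements. A cochain is extended by \<open>0\<close> to all other index sets, so
  the same formula gives the differentials in all cohomological degrees.
\<close>
definition cech_cochains ::
    "'a::comm_ring_1 ring \<Rightarrow> nat set \<Rightarrow> (nat \<Rightarrow> 'a) \<Rightarrow> nat \<Rightarrow> (nat set \<Rightarrow> 'a) set" where
  "cech_cochains R A x i =
    {c. \<forall>\<sigma>. if \<sigma> \<subseteq> A \<and> card \<sigma> = i then c \<sigma> \<in> localization R (\<Prod>a\<in>\<sigma>. x a) else c \<sigma> = 0}"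

definition cech_diff :: "nat set \<Rightarrow> (nat set \<Rightarrow> 'a::comm_ring_1) \<Rightarrow> nat set \<Rightarrow> 'a" where
  "cech_diff A c \<tau> =
    (if \<tau> \<subseteq> A then \<Sum>a\<in>\<tau>. (- 1) ^ card {b \<in> \<tau>. b < a} * c (\<tau> - {a}) else 0)"

definition cech_cocycles ::
    "'a::comm_ring_1 ring \<Rightarrow> nat set \<Rightarrow> (nat \<Rightarrow> 'a) \<Rightarrow> nat \<Rightarrow> (nat set \<Rightarrow> 'a) monoid" where
  "cech_cocycles R A x i =
    \<lparr> carrier = {c \<in> cech_cochains R A x i. cech_diff A c = (\<lambda>_. 0)},
      mult = (\<lambda>c d \<sigma>. c \<sigma> + d \<sigma>), one = (\<lambda>_. 0) \<rparr>"

definition cech_coboundaries ::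
    "'a::comm_ring_1 ring \<Rightarrow> nat set \<Rightarrow> (nat \<Rightarrow> 'a) \<Rightarrow> nat \<Rightarrow> (nat set \<Rightarrow> 'a) set" where
  "cech_coboundaries R A x i =
    (if i = 0 then {\<lambda>_. 0} else cech_diff A ` cech_cochains R A x (i - 1))"

text \<open>
  The local cohomology of \<open>R\<close> with support in the ideal generated by the family \<open>(x\<^sub>a)\<close>, \<open>a \<in> A\<close>.
\<close>
definition local_cohomology ::
    "'a::comm_ring_1 ring \<Rightarrow> nat set \<Rightarrow> (nat \<Rightarrow> 'a) \<Rightarrow> nat \<Rightarrow> (nat set \<Rightarrow> 'a) set monoid" where
  "local_cohomology R A x i = cech_cocycles R A x i Mod cech_coboundaries R A x i"

text \<open>
  The piece of degree \<open>j\<close> of the \<open>i\<close>-th local cohomology of \<open>R\<close> with support in \<open>\<mm>\<close>, which is generated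
  by the monomials \<open>generator \<alpha> a\<close>, \<open>a \<in> A\<close> (see \<open>max_homogeneous_ideal_eq\<close> below): the classes
  of the cocycles that are homogeneous of degree \<open>j\<close>.
\<close>
definition local_cohomology_piece ::
    "nat \<Rightarrow> nat set \<Rightarrow> 'k::field laurent ring \<Rightarrow> nat \<Rightarrow> int \<Rightarrow> (nat set \<Rightarrow> 'k laurent) set set" where
  "local_cohomology_piece \<alpha> A R i j =
    {cech_coboundaries R A (generator \<alpha>) i #>\<^bsub>cech_cocycles R A (generator \<alpha>) i\<^esub> z | z.
       z \<in> carrier (cech_cocycles R A (generator \<alpha>) i) \<and> (\<forall>\<sigma>. homogeneous \<alpha> j (z \<sigma>))}"

definition regularity :: "nat \<Rightarrow> nat set \<Rightarrow> 'k::field laurent ring \<Rightarrow> int" where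
  "regularity \<alpha> A R = (LEAST n.
     \<forall>i j. n < j \<longrightarrow>
       local_cohomology_piece \<alpha> A R i (j - int i)
         = {\<one>\<^bsub>local_cohomology R A (generator \<alpha>) i\<^esub>})"


section \<open>Well-definedness\<close>

lemma map_prod_int_add: "map_prod int int (s + t) = map_prod int int s + map_prod int int t"
  by (cases s; cases t) simp

lemma assoc_semigroup_add:
  assumes "t \<in> assoc_semigroup \<alpha> A" "s \<in> assoc_semigroup \<alpha> A"
  shows "s + t \<in> assoc_semigroup \<alpha> A"
  using assms
proof (induction t rule: assoc_semigroup.induct)
  case zero
  then show ?case by (simp add: zero_prod_def[symmetric])
next
  case (add t a)
  then have "(s + t) + (a, \<alpha> - a) \<in> assoc_semigroup \<alpha> A"
    by (intro assoc_semigroup.add) auto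
  then show ?case by (simp only: add.assoc)
qed

lemma semigroup_ring_simps [simp]:
  "f \<in> carrier (semigroup_ring S) \<longleftrightarrow> Poly_Mapping.keys f \<subseteq> map_prod int int ` S"
  "f \<otimes>\<^bsub>semigroup_ring S\<^esub> g = f * g" "f \<oplus>\<^bsub>semigroup_ring S\<^esub> g = f + g"
  "\<one>\<^bsub>semigroup_ring S\<^esub> = 1" "\<zero>\<^bsub>semigroup_ring S\<^esub> = 0"
  by (simp_all add: semigroup_ring_def)

lemma cring_semigroup_ring:
  "cring (semigroup_ring (assoc_semigroup \<alpha> A) :: 'k::field laurent ring)"
proof -
  let ?T = "map_prod int int ` assoc_semigroup \<alpha> A"
  let ?R = "semigroup_ring (assoc_semigroup \<alpha> A) :: 'k laurent ring"
  have zero: "(0, 0) \<in> ?T"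
    using assoc_semigroup.zero[of \<alpha> A] by force
  have add: "u + v \<in> ?T" if uv: "u \<in> ?T" "v \<in> ?T" for u v
  proof -
    from uv(1) obtain s where s: "u = map_prod int int s" "s \<in> assoc_semigroup \<alpha> A"
      by (rule imageE)
    from uv(2) obtain t where t: "v = map_prod int int t" "t \<in> assoc_semigroup \<alpha> A"
      by (rule imageE)
    show ?thesis
      using assoc_semigroup_add[OF t(2) s(2)]
      by (intro image_eqI[of _ _ "s + t"]) (simp_all only: s(1) t(1) map_prod_int_add)
  qed
  have plus: "Poly_Mapping.keys (f + g) \<subseteq> ?T"
    if "Poly_Mapping.keys f \<subseteq> ?T" "Poly_Mapping.keys g \<subseteq> ?T" for f g :: "'k laurent"
    using that Poly_Mapping.keys_add[of f g] by blast
  have times: "Poly_Mapping.keys (f * g) \<subseteq> ?T"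
    if fg: "Poly_Mapping.keys f \<subseteq> ?T" "Poly_Mapping.keys g \<subseteq> ?T" for f g :: "'k laurent"
  proof
    fix w assume "w \<in> Poly_Mapping.keys (f * g)"
    then obtain u v where uv: "w = u + v" "u \<in> Poly_Mapping.keys f" "v \<in> Poly_Mapping.keys g"
      using keys_mult[of f g] by blast
    show "w \<in> ?T"
      unfolding uv(1) using uv(2,3) fg by (intro add) (erule subsetD[rotated], assumption)+
  qed
  have one: "Poly_Mapping.keys (1 :: 'k laurent) \<subseteq> ?T"
    using zero by (simp add: zero_prod_def)
  show ?thesis
  proof (rule cringI)
    show "abelian_group ?R"
    proof (rule abelian_groupI)
      fix f assume f: "f \<in> carrier ?R"
      then have "- f \<in> carrier ?R" by simp
      moreover have "- f \<oplus>\<^bsub>?R\<^esub> f = \<zero>\<^bsub>?R\<^esub>" by simp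
      ultimately show "\<exists>g\<in>carrier ?R. g \<oplus>\<^bsub>?R\<^esub> f = \<zero>\<^bsub>?R\<^esub>" by blast
    qed (simp_all only: semigroup_ring_simps plus ac_simps add_0_left add_0_right
        keys_zero empty_subsetI)
    show "comm_monoid ?R"
      by (rule comm_monoidI)
        (simp_all only: semigroup_ring_simps times one ac_simps mult_1_left mult_1_right)
  qed (simp add: distrib_right)
qed

lemma generator_in_carrier:
  assumes "A \<subseteq> {..\<alpha>}" "a \<in> A"
  shows "map_prod int int (a, \<alpha> - a) = (int a, int \<alpha> - int a)"
    and "(a, \<alpha> - a) \<in> assoc_semigroup \<alpha> A"
  using assms assoc_semigroup.add[OF assoc_semigroup.zero, of a A \<alpha>]
  by (auto simp: zero_prod_def[symmetric])

lemma max_homogeneous_ideal_eq: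
  fixes R :: "'k::field laurent ring"
  assumes "0 < \<alpha>" "A \<subseteq> {..\<alpha>}" and R: "R = semigroup_ring (assoc_semigroup \<alpha> A)"
  shows "max_homogeneous_ideal R = Idl\<^bsub>R\<^esub> (generator \<alpha> ` A)"
proof
  let ?S = "assoc_semigroup \<alpha> A" and ?I = "Idl\<^bsub>R\<^esub> (generator \<alpha> ` A)"
  interpret cring R unfolding R by (rule cring_semigroup_ring)
  have gen: "generator \<alpha> ` A \<subseteq> max_homogeneous_ideal R"
    using assms(1) generator_in_carrier[OF assms(2)]
    by (force simp: max_homogeneous_ideal_def generator_def R lookup_single when_def image_iff)
  have nonneg: "0 \<le> fst u \<and> 0 \<le> snd u" if "u \<in> map_prod int int ` ?S" for u
    using that by auto
  have "ideal (max_homogeneous_ideal R) R"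
  proof (rule idealI)
    show "subgroup (max_homogeneous_ideal R) (add_monoid R)"
    proof (rule group.subgroupI[OF a_group])
      fix f assume f: "f \<in> max_homogeneous_ideal R"
      then have "f \<in> carrier R" "- f \<in> carrier R" "f + - f = 0"
        by (auto simp: max_homogeneous_ideal_def R)
      then have "\<ominus>\<^bsub>R\<^esub> f = - f"
        by (intro minus_equality) (auto simp: R)
      then show "inv\<^bsub>add_monoid R\<^esub> f \<in> max_homogeneous_ideal R"
        using f by (auto simp: max_homogeneous_ideal_def R a_inv_def)
    next
      fix f g assume "f \<in> max_homogeneous_ideal R" "g \<in> max_homogeneous_ideal R"
      then show "f \<otimes>\<^bsub>add_monoid R\<^esub> g \<in> max_homogeneous_ideal R"
        using Poly_Mapping.keys_add[of f g] by (auto simp: max_homogeneous_ideal_def R lookup_add)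
    next
      show "max_homogeneous_ideal R \<noteq> {}"
        by (auto simp: max_homogeneous_ideal_def R intro!: exI[of _ 0])
    qed (simp add: max_homogeneous_ideal_def)
  next
    fix a x assume a: "a \<in> max_homogeneous_ideal R" and x: "x \<in> carrier R"
    then have a': "a \<in> carrier R"
      by (simp add: max_homogeneous_ideal_def)
    have "(0, 0) \<notin> Poly_Mapping.keys (x * a)"
    proof
      assume "(0, 0) \<in> Poly_Mapping.keys (x * a)"
      then obtain u v where uv: "u \<in> Poly_Mapping.keys x" "v \<in> Poly_Mapping.keys a" "(0, 0) = u + v"
        using keys_mult[of x a] by blast
      with x a' have "u \<in> map_prod int int ` ?S" "v \<in> map_prod int int ` ?S"
        by (auto simp: R)
      from this[THEN nonneg] uv(3) have "v = (0, 0)"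
        by (cases u; cases v) auto
      with uv(2) have "(0, 0) \<in> Poly_Mapping.keys a"
        by simp
      moreover have "Poly_Mapping.lookup a (0, 0) = 0"
        using a by (simp add: max_homogeneous_ideal_def)
      ultimately show False
        by (simp add: in_keys_iff)
    qed
    moreover have "x \<otimes>\<^bsub>R\<^esub> a \<in> carrier R"
      using x a' by blast
    ultimately show "x \<otimes>\<^bsub>R\<^esub> a \<in> max_homogeneous_ideal R"
      by (simp add: max_homogeneous_ideal_def R in_keys_iff)
    then show "a \<otimes>\<^bsub>R\<^esub> x \<in> max_homogeneous_ideal R"
      by (simp add: R mult.commute)
  qed (rule ring_axioms)
  then show "Idl\<^bsub>R\<^esub> (generator \<alpha> ` A) \<subseteq> max_homogeneous_ideal R"
    using gen by (rule genideal_minimal)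
  have "generator \<alpha> ` A \<subseteq> carrier R"
    using gen by (auto simp: max_homogeneous_ideal_def)
  then have I: "ideal ?I R"
    and self: "generator \<alpha> ` A \<subseteq> ?I"
    by (rule genideal_ideal, rule genideal_self)
  have mon: "Poly_Mapping.single (map_prod int int s) c \<in> ?I" if "s \<in> ?S" "s \<noteq> 0" for s and c :: 'k
    using that
  proof cases
    case (add s' a)
    then have "Poly_Mapping.single (map_prod int int s') c \<otimes>\<^bsub>R\<^esub> generator \<alpha> a \<in> ?I"
      using self by (intro ideal.I_l_closed[OF I]) (auto simp: R)
    then show ?thesis
      using add generator_in_carrier(1)[OF assms(2)]
      by (simp add: R generator_def mult_single map_prod_int_add del: map_prod_simp)
  qed (simp add: zero_prod_def)
  show "max_homogeneous_ideal R \<subseteq> ?I"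
  proof
    fix f assume f: "f \<in> max_homogeneous_ideal R"
    have single: "Poly_Mapping.single u (Poly_Mapping.lookup f u) \<in> ?I"
      if u: "u \<in> Poly_Mapping.keys f" for u
    proof -
      from u f have "u \<in> map_prod int int ` ?S"
        by (auto simp: max_homogeneous_ideal_def R)
      then obtain s where s: "s \<in> ?S" "u = map_prod int int s"
        by (rule imageE)
      moreover have "s \<noteq> 0"
      proof
        assume "s = 0"
        with s(2) u have "Poly_Mapping.lookup f (0, 0) \<noteq> 0"
          by (simp add: zero_prod_def in_keys_iff)
        with f show False by (simp add: max_homogeneous_ideal_def)
      qed
      ultimately show ?thesis
        using mon by blast
    qed
    have "(\<Sum>u\<in>U. Poly_Mapping.single u (Poly_Mapping.lookup f u)) \<in> ?I"
      if "finite U" "U \<subseteq> Poly_Mapping.keys f" for U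
      using that
    proof (induction U rule: finite_induct)
      case empty
      then show ?case
        using additive_subgroup.zero_closed[OF ideal.axioms(1)[OF I]] by (simp add: R)
    next
      case (insert u U)
      then show ?case
        using additive_subgroup.a_closed[OF ideal.axioms(1)[OF I] single[of u]] by (simp add: R)
    qed
    from this[OF finite_keys order_refl]
    have "(\<Sum>u\<in>Poly_Mapping.keys f. Poly_Mapping.single u (Poly_Mapping.lookup f u)) \<in> ?I" .
    moreover have "(\<Sum>u\<in>Poly_Mapping.keys f. Poly_Mapping.single u (Poly_Mapping.lookup f u)) = f"
      by (rule poly_mapping_eqI) (simp add: lookup_sum lookup_single when_def in_keys_iff)
    ultimately show "f \<in> ?I" by simp
  qed
qed

end

theory Submission
  imports Defs
begin

text \<open>
  Call \<open>n\<close> full if the \<open>n\<close>-fold sumset of \<open>A\<close> is all of \<open>{0..n * \<alpha>}\<close>, and let \<open>N\<close> be the least positive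
  full number; both invariants are equal to \<open>N\<close>. As \<open>A\<close> contains \<open>0, 1, \<alpha> - 1, \<alpha>\<close>, the semigroup \<open>S\<close>
  has only finitely many holes in \<open>{(u, v). \<alpha> dvd u + v}\<close>. The holes give \<open>H\<^sup>1\<close>, whose top degree
  is \<open>N - 1\<close> if there are any, and \<open>H\<^sup>2\<close> has top degree \<open>-1\<close>, so that the regularity is \<open>N\<close>. Clearly
  \<open>\<mm>\<^sup>N\<^sup>+\<^sup>1 = \<qq>\<mm>\<^sup>N\<close>. Since \<open>p \<ge> \<alpha> - q\<close>, an \<open>n\<close> that is not full has a hole \<open>x > (n - 1) * \<alpha>\<close>.
  For such an \<open>x\<close> with \<open>n = N - 1\<close>, the number \<open>x + \<alpha>\<close> lies in the \<open>N\<close>-fold sumset,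
  but neither \<open>x\<close> nor \<open>x + \<alpha>\<close> lies in the \<open>(N - 1)\<close>-fold one, which rules out smaller reduction numbers.
\<close>

section \<open>Sumsets\<close>

primrec sumset :: "nat set \<Rightarrow> nat \<Rightarrow> nat set" where
  "sumset A 0 = {0}"
| "sumset A (Suc n) = {x + a | x a. x \<in> sumset A n \<and> a \<in> A}"

lemma sumset_Suc_I: "x \<in> sumset A n \<Longrightarrow> a \<in> A \<Longrightarrow> x + a \<in> sumset A (Suc n)"
  by auto

lemma sumset_Suc_E:
  assumes "x \<in> sumset A (Suc n)"
  obtains y a where "x = y + a" "y \<in> sumset A n" "a \<in> A"
  using assms by auto

lemma sumset_mult: "a \<in> A \<Longrightarrow> k * a \<in> sumset A k"
proof (induction k)
  case (Suc k)
  then have "k * a + a \<in> sumset A (Suc k)"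
    by (intro sumset_Suc_I)
  then show ?case
    by (simp only: mult_Suc add.commute)
qed simp

lemma sumset_add: "x \<in> sumset A m \<Longrightarrow> y \<in> sumset A n \<Longrightarrow> x + y \<in> sumset A (m + n)"
  by (induction n arbitrary: y) (simp, fastforce simp: add.assoc[symmetric])

lemma sumset_le: "A \<subseteq> {..b} \<Longrightarrow> x \<in> sumset A n \<Longrightarrow> x \<le> n * b"
  by (induction n arbitrary: x) (simp, fastforce)

text \<open>Every generator has coordinate sum \<alpha>, so a point of the semigroup amounts to its
  first coordinate together with its degree \<open>n\<close>. This turns questions about
  \<open>S\<close> into questions about sumsets.\<close>

lemma mem_assoc_semigroup_iff:
  assumes "A \<subseteq> {..\<alpha>}"
  shows "(x, y) \<in> assoc_semigroup \<alpha> A \<longleftrightarrow> (\<exists>n. x + y = n * \<alpha> \<and> x \<in> sumset A n)"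
proof
  have "\<exists>n. fst s + snd s = n * \<alpha> \<and> fst s \<in> sumset A n" if "s \<in> assoc_semigroup \<alpha> A" for s
    using that
  proof (induction rule: assoc_semigroup.induct)
    case zero
    then show ?case by (auto intro!: exI[of _ 0])
  next
    case (add s a)
    then obtain n where "fst s + snd s = n * \<alpha>" "fst s \<in> sumset A n"
      by blast
    with add(2) assms show ?case
      by (intro exI[of _ "Suc n"]) auto
  qed
  then show "\<exists>n. x + y = n * \<alpha> \<and> x \<in> sumset A n" if "(x, y) \<in> assoc_semigroup \<alpha> A"
    using that by fastforce
next
  have "(x, y) \<in> assoc_semigroup \<alpha> A" if "x \<in> sumset A n" "x + y = n * \<alpha>" for n
    using that
  proof (induction n arbitrary: x y)
    case 0
    then show ?case by (simp add: assoc_semigroup.zero)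
  next
    case (Suc n)
    then obtain x' a where x: "x = x' + a" "x' \<in> sumset A n" "a \<in> A"
      by auto
    have a: "a \<le> \<alpha>" and x': "x' \<le> n * \<alpha>"
      using x(3) assms sumset_le[OF assms x(2)] by auto
    then have "(x', n * \<alpha> - x') \<in> assoc_semigroup \<alpha> A"
      using Suc.IH[OF x(2)] by simp
    from assoc_semigroup.add[OF this x(3)] have "(x, n * \<alpha> - x' + (\<alpha> - a)) \<in> assoc_semigroup \<alpha> A"
      using x(1) by simp
    moreover have "n * \<alpha> - x' + (\<alpha> - a) = y"
      using Suc.prems(2) x(1) a x' by simp
    ultimately show ?case by simp
  qed
  then show "\<exists>n. x + y = n * \<alpha> \<and> x \<in> sumset A n \<Longrightarrow> (x, y) \<in> assoc_semigroup \<alpha> A"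
    by blast
qed

text \<open>The shape of the set of the theorem: an initial interval, a jump from \<open>p\<close>
  to \<open>q\<close>, then elements up to \<alpha>. The assumption \<open>gap\<close> is \<alpha> -
  q \<le> p, written without truncated subtraction.\<close>

locale gap_set =
  fixes \<alpha> p q :: nat and A :: "nat set"
  assumes p_pos: "0 < p" and p_less: "p < q" and q_less: "q < \<alpha>" and gap: "\<alpha> \<le> p + q"
    and low: "{0..p} \<subseteq> A" and high: "q \<in> A" "\<alpha> - 1 \<in> A" "\<alpha> \<in> A"
    and A_sub: "A \<subseteq> {0..p} \<union> {q..\<alpha>}"
begin

section \<open>Fullness of sumsets and the threshold \<open>N\<close>\<close>

definition "full n \<longleftrightarrow> {0..n * \<alpha>} \<subseteq> sumset A n"

lemma A_le: "A \<subseteq> {..\<alpha>}"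
  using A_sub p_less q_less by fastforce

lemma zero_in: "0 \<in> A" and one_in: "1 \<in> A"
  using low p_pos by auto

text \<open>The translates of {0..n * \<alpha>} by 0 and by \<alpha> cover the next interval as soon
  as \<open>n\<close> is positive.\<close>

lemma full_Suc:
  assumes "full n" "0 < n"
  shows "full (Suc n)"
  unfolding full_def
proof
  fix x assume x: "x \<in> {0..Suc n * \<alpha>}"
  show "x \<in> sumset A (Suc n)"
  proof (cases "x \<le> n * \<alpha>")
    case True
    then have "x + 0 \<in> sumset A (Suc n)"
      using assms(1) zero_in by (intro sumset_Suc_I) (auto simp: full_def)
    then show ?thesis by simp
  next
    case False
    moreover have "\<alpha> \<le> n * \<alpha>"
      using assms(2) by simp
    ultimately have "\<alpha> \<le> x" "x - \<alpha> \<in> {0..n * \<alpha>}"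
      using x by (linarith, auto)
    then have "(x - \<alpha>) + \<alpha> \<in> sumset A (Suc n)"
      using assms(1) high(3) by (intro sumset_Suc_I) (auto simp: full_def)
    then show ?thesis
      using \<open>\<alpha> \<le> x\<close> by simp
  qed
qed

text \<open>An element of the sumset either has a summand in \<open>{0..p}\<close> or has all summands in \<open>{q..\<alpha>}\<close>.\<close>
lemma sumset_dichotomy: "x \<in> sumset A n \<Longrightarrow> n * q \<le> x \<or> x + \<alpha> \<le> n * \<alpha> + p"
proof (induction n arbitrary: x)
  case (Suc n)
  then obtain x' a where x: "x = x' + a" "x' \<in> sumset A n" "a \<in> A"
    by auto
  have "x' \<le> n * \<alpha>"
    by (rule sumset_le[OF A_le x(2)])
  moreover have "a \<le> p \<or> q \<le> a \<and> a \<le> \<alpha>"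
    using x(3) A_sub by auto
  ultimately show ?case
    using Suc.IH[OF x(2)] x(1) by auto
qed simp

text \<open>Sums of \<open>k\<close> copies of \<open>q\<close> and \<alpha> form a progression from
  \<open>k * q\<close> to \<open>k * \<alpha>\<close> with step \<alpha> - q \<le> p, so one of them
  lies within \<open>p\<close> below \<open>y\<close>.\<close>

lemma sumset_approx:
  "k * q \<le> y \<Longrightarrow> y \<le> k * \<alpha> + p \<Longrightarrow> \<exists>z \<in> sumset A k. z \<le> y \<and> y \<le> z + p"
proof (induction k arbitrary: y)
  case (Suc k)
  show ?case
  proof (cases "k * q + \<alpha> \<le> y")
    case True
    then have "k * q \<le> y - \<alpha>" "y - \<alpha> \<le> k * \<alpha> + p"
      using Suc.prems by auto
    from Suc.IH[OF this] obtain z where "z \<in> sumset A k" "z \<le> y - \<alpha>" "y - \<alpha> \<le> z + p"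
      by blast
    then show ?thesis
      using high(3) True by (intro bexI[of _ "z + \<alpha>"] sumset_Suc_I) auto
  next
    case False
    then show ?thesis
      using Suc.prems gap sumset_mult[OF high(1), of "Suc k"]
      by (intro bexI[of _ "Suc k * q"]) auto
  qed
qed simp

text \<open>A sum of \<open>k\<close> elements approximates \<open>y\<close> from below, and
  \<open>m\<close> further summands from {0..p} make up the difference, which is at most
  \<open>m * p\<close>.\<close>

lemma sumset_interval:
  assumes "0 < m" "k * q \<le> y" "y \<le> k * \<alpha> + m * p"
  shows "y \<in> sumset A (k + m)"
proof -
  obtain z where z: "z \<in> sumset A k" "z \<le> y" "y \<le> z + m * p"
  proof (cases "y \<le> k * \<alpha> + p")
    case True
    then obtain z where "z \<in> sumset A k" "z \<le> y" "y \<le> z + p"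
      using sumset_approx assms(2) by blast
    moreover have "p \<le> m * p"
      using assms(1) by simp
    ultimately show ?thesis
      by (intro that) (assumption, assumption, linarith)
  next
    case False
    then show ?thesis
      using assms(3) sumset_mult[OF high(3), of k] by (intro that[of "k * \<alpha>"]) auto
  qed
  have "d \<in> sumset A n" if "d \<le> n * p" for d n
    using that
  proof (induction n arbitrary: d)
    case (Suc n)
    have "(d - min d p) + min d p \<in> sumset A (Suc n)"
      using Suc low by (intro sumset_Suc_I) auto
    then show ?case by simp
  qed simp
  from sumset_add[OF z(1) this[of "y - z"]] z show ?thesis
    by auto
qed

text \<open>
  The sumset contains the intervals \<open>{k * q..k * \<alpha> + (n - k) * p}\<close> for \<open>k < n\<close>. The gaps between
  consecutive intervals grow with \<open>k\<close>, because \<open>\<alpha> - q \<le> p\<close>, so that it suffices to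
  look at the last one.
\<close>
lemma full_if_top_full:
  assumes "0 < n" and top: "{(n - 1) * \<alpha><..n * \<alpha>} \<subseteq> sumset A n"
  shows "full n"
  unfolding full_def
proof
  obtain m where n: "n = Suc m"
    using assms(1) by (cases n) auto
  \<comment> \<open>A sum with a summand in {0..p} is at most \<open>m * \<alpha> + p\<close>. So
    all \<open>n\<close> summands of this number are at least \<open>q\<close>, which bounds the
    length of the last gap.\<close>
  have "m * \<alpha> + p + 1 \<in> sumset A n"
    using p_less q_less by (intro subsetD[OF top]) (auto simp: n)
  from sumset_dichotomy[OF this] have last: "m * q + q \<le> m * \<alpha> + p + 1"
    by (auto simp: n)
  fix x assume x: "x \<in> {0..n * \<alpha>}"
  show "x \<in> sumset A n"
  proof (cases "m * q \<le> x")
    case True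
    show ?thesis
    proof (cases "x \<le> m * \<alpha> + p")
      case True
      then show ?thesis
        using sumset_interval[of 1 m x] \<open>m * q \<le> x\<close> by (simp add: n)
    next
      case False
      then show ?thesis
        using x by (intro subsetD[OF top]) (auto simp: n)
    qed
  next
    case False
    define k where "k = x div q"
    have k: "k * q \<le> x" "x < k * q + q"
      using p_less dividend_less_div_times[of q x] by (auto simp: k_def add.commute)
    then have "k < m"
      using False by (metis less_le_trans mult_le_mono1 not_le le_trans)
    then obtain d where d: "m = k + d" "0 < d"
      by (metis less_imp_add_positive)
    \<comment> \<open>Passing from \<open>m\<close> down to \<open>k\<close> costs \<open>d\<close>
      times \<alpha> - q, and each of the \<open>d\<close> summands that become free pays for it
      with \<open>p\<close>. Hence \<open>last\<close> still puts \<open>x\<close> into the interval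
      that starts at \<open>k * q\<close>.\<close>
    have "d * \<alpha> \<le> d * p + d * q"
      using gap by (metis add_mult_distrib2 mult_le_mono2)
    then have "x \<le> k * \<alpha> + Suc d * p"
      using last k(2) by (simp add: d add_mult_distrib)
    from sumset_interval[OF _ k(1) this] show ?thesis
      by (simp add: n d)
  qed
qed

text \<open>Makes \<open>N\<close> well defined. Only the top block matters by
  \<open>full_if_top_full\<close>, and its element \<open>\<alpha> * \<alpha> - j\<close> is the sum
  of \<open>j\<close> copies of \<alpha> - 1 and \<alpha> - j copies of \<alpha>.\<close>

lemma full_alpha: "full \<alpha>"
proof (rule full_if_top_full)
  show "{(\<alpha> - 1) * \<alpha><..\<alpha> * \<alpha>} \<subseteq> sumset A \<alpha>"
  proof
    fix x assume x: "x \<in> {(\<alpha> - 1) * \<alpha><..\<alpha> * \<alpha>}"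
    define j where "j = \<alpha> * \<alpha> - x"
    have j: "j \<le> \<alpha>" "x = \<alpha> * \<alpha> - j"
      using x by (auto simp: j_def diff_mult_distrib)
    then obtain i where i: "\<alpha> = i + j"
      by (metis le_add_diff_inverse2)
    have "i * \<alpha> + j * (\<alpha> - 1) \<in> sumset A (i + j)"
      by (intro sumset_add sumset_mult high)
    moreover have "i * \<alpha> + j * (\<alpha> - 1) = x"
      using q_less unfolding j(2) by (subst i) (simp add: algebra_simps diff_mult_distrib2)
    ultimately show "x \<in> sumset A \<alpha>"
      using i by simp
  qed
qed (use q_less in simp)

text \<open>Zero is left out because \<open>full 0\<close> always holds and \<open>full_Suc\<close>
  cannot start from it.\<close>

definition "N = (LEAST n. 0 < n \<and> full n)"

lemma N_pos: "0 < N" and full_N: "full N"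
  using LeastI[of "\<lambda>n. 0 < n \<and> full n" \<alpha>] full_alpha q_less by (auto simp: N_def)

lemma full_ge: "N \<le> n \<Longrightarrow> full n"
  by (induction n rule: dec_induct) (use N_pos in \<open>auto intro: full_N full_Suc\<close>)

lemma not_full: "0 < n \<Longrightarrow> n < N \<Longrightarrow> \<not> full n"
  unfolding N_def by (blast dest: not_less_Least)

text \<open>The contrapositive of \<open>full_if_top_full\<close> at \<open>N - 1\<close>. The
  position of the hole in the top block is what \<open>T_red_not_full\<close> relies on.\<close>

lemma hole:
  assumes "1 < N"
  obtains x where "(N - 2) * \<alpha> < x" "x \<le> (N - 1) * \<alpha>" "x \<notin> sumset A (N - 1)"
proof -
  have "\<not> {(N - 1 - 1) * \<alpha><..(N - 1) * \<alpha>} \<subseteq> sumset A (N - 1)"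
    using full_if_top_full[of "N - 1"] not_full[of "N - 1"] assms by auto
  then obtain x where "x \<in> {(N - 1 - 1) * \<alpha><..(N - 1) * \<alpha>}" "x \<notin> sumset A (N - 1)"
    by blast
  then show ?thesis
    by (intro that[of x]) (simp_all add: numeral_2_eq_2)
qed

end

section \<open>Monomial ideals\<close>

text \<open>All ideals and localizations below are spanned by monomials. Passing to exponent sets is
  injective (\<open>monomial_span_eq_iff\<close>), so equations of ideals become equations of sets
  of lattice points.\<close>

definition monomial_span :: "(int \<times> int) set \<Rightarrow> 'k::field laurent set" where
  "monomial_span W = {f. Poly_Mapping.keys f \<subseteq> W}"

lemma carrier_semigroup_ring: "carrier (semigroup_ring S) = monomial_span (map_prod int int ` S)"
  by (simp add: semigroup_ring_def monomial_span_def)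

lemma single_in_monomial_span: "w \<in> W \<Longrightarrow> Poly_Mapping.single w c \<in> monomial_span W"
  by (simp add: monomial_span_def)

lemma monomial_span_subset_iff:
  "(monomial_span V :: 'k::field laurent set) \<subseteq> monomial_span W \<longleftrightarrow> V \<subseteq> W"
proof
  assume sub: "(monomial_span V :: 'k laurent set) \<subseteq> monomial_span W"
  show "V \<subseteq> W"
  proof
    fix w assume "w \<in> V"
    then have "(Poly_Mapping.single w 1 :: 'k laurent) \<in> monomial_span W"
      using sub single_in_monomial_span by blast
    then show "w \<in> W"
      by (simp add: monomial_span_def)
  qed
qed (auto simp: monomial_span_def)

lemma monomial_span_eq_iff:
  "(monomial_span V :: 'k::field laurent set) = monomial_span W \<longleftrightarrow> V = W"
  by (metis monomial_span_subset_iff order_antisym order_refl)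

lemma monomial_span_subsetI:
  fixes I :: "'k::field laurent set"
  assumes "0 \<in> I" "\<And>f g. f \<in> I \<Longrightarrow> g \<in> I \<Longrightarrow> f + g \<in> I"
    and "\<And>w c. w \<in> W \<Longrightarrow> Poly_Mapping.single w c \<in> I"
  shows "monomial_span W \<subseteq> I"
proof
  fix f :: "'k laurent" assume f: "f \<in> monomial_span W"
  have "(\<Sum>u\<in>U. Poly_Mapping.single u (Poly_Mapping.lookup f u)) \<in> I" if "finite U" "U \<subseteq> W" for U
    using that by (induction U rule: finite_induct) (auto intro: assms)
  from this[OF finite_keys] f
  have "(\<Sum>u\<in>Poly_Mapping.keys f. Poly_Mapping.single u (Poly_Mapping.lookup f u)) \<in> I"
    by (simp add: monomial_span_def)
  moreover have "(\<Sum>u\<in>Poly_Mapping.keys f. Poly_Mapping.single u (Poly_Mapping.lookup f u)) = f"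
    by (rule poly_mapping_eqI) (simp add: lookup_sum lookup_single when_def in_keys_iff)
  ultimately show "f \<in> I" by simp
qed

lemma monomial_span_add: "f \<in> monomial_span W \<Longrightarrow> g \<in> monomial_span W \<Longrightarrow> f + g \<in> monomial_span W"
  using Poly_Mapping.keys_add[of f g] by (auto simp: monomial_span_def)

lemma monomial_span_mult:
  "f \<in> monomial_span V \<Longrightarrow> g \<in> monomial_span W \<Longrightarrow>
    f * g \<in> monomial_span {v + w | v w. v \<in> V \<and> w \<in> W}"
  using keys_mult[of f g] by (fastforce simp: monomial_span_def)

text \<open>\<open>ideal_prod\<close> is the additive closure of the products of elements, and a
  term with exponent \<open>v + w\<close> is a product of two terms, one of which carries the
  coefficient.\<close>

lemma ideal_prod_monomial_span:
  "monomial_span V \<cdot>\<^bsub>semigroup_ring S\<^esub> monomial_span W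
    = (monomial_span {v + w | v w. v \<in> V \<and> w \<in> W} :: 'k::field laurent set)"
    (is "?P = ?M")
proof
  show "?P \<subseteq> ?M"
  proof
    show "f \<in> ?M" if "f \<in> ?P" for f
      using that
    proof (induction f rule: ideal_prod.induct)
      case (prod f g)
      then show ?case
        by (simp only: semigroup_ring_simps monomial_span_mult)
    next
      case (sum f g)
      then show ?case
        by (simp only: semigroup_ring_simps monomial_span_add)
    qed
  qed
  show "?M \<subseteq> ?P"
  proof (rule monomial_span_subsetI)
    have "0 * 0 \<in> ?P"
      using ideal_prod.prod[of 0 "monomial_span V" 0 "monomial_span W" "semigroup_ring S"]
      by (simp add: monomial_span_def)
    then show "0 \<in> ?P" by simp
  next
    fix u and c :: 'k assume "u \<in> {v + w | v w. v \<in> V \<and> w \<in> W}"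
    then obtain v w where u: "u = v + w" "v \<in> V" "w \<in> W"
      by blast
    then have "(Poly_Mapping.single v c :: 'k laurent) * Poly_Mapping.single w 1 \<in> ?P"
      using ideal_prod.prod[of "Poly_Mapping.single v c" "monomial_span V" "Poly_Mapping.single w 1"
          "monomial_span W" "semigroup_ring S"]
      by (simp add: single_in_monomial_span)
    then show "Poly_Mapping.single u c \<in> ?P"
      by (simp add: u(1) mult_single)
  next
    fix f g assume "f \<in> ?P" "g \<in> ?P"
    then show "f + g \<in> ?P"
      using ideal_prod.sum[of f "semigroup_ring S" "monomial_span V" "monomial_span W" g] by simp
  qed
qed

text \<open>The exponents \<open>g + t\<close> are stable under adding elements of \<open>T\<close>,
  so their span is an ideal. Conversely, each such monomial is a multiple of a generator.\<close>

lemma genideal_monomials: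
  fixes \<alpha> A
  defines "R \<equiv> semigroup_ring (assoc_semigroup \<alpha> A) :: 'k::field laurent ring"
    and "T \<equiv> map_prod int int ` assoc_semigroup \<alpha> A"
  assumes "G \<subseteq> T"
  shows "Idl\<^bsub>R\<^esub> ((\<lambda>w. Poly_Mapping.single w 1) ` G) = monomial_span {g + t | g t. g \<in> G \<and> t \<in> T}"
    (is "Idl\<^bsub>R\<^esub> ?X = monomial_span ?W")
proof
  interpret cring R
    unfolding R_def by (rule cring_semigroup_ring)
  have carr: "carrier R = monomial_span T"
    by (simp add: R_def T_def carrier_semigroup_ring)
  have X: "?X \<subseteq> carrier R"
    using assms(3) by (auto simp: carr intro: single_in_monomial_span)
  have zero: "(0, 0) \<in> T"
    unfolding T_def using assoc_semigroup.zero by force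
  have add: "s + t \<in> T" if "s \<in> T" "t \<in> T" for s t
    using that assoc_semigroup_add unfolding T_def
    by (auto simp only: image_iff map_prod_int_add[symmetric])
  show "monomial_span ?W \<subseteq> Idl\<^bsub>R\<^esub> ?X"
  proof (rule monomial_span_subsetI)
    interpret I: ideal "Idl\<^bsub>R\<^esub> ?X" R
      using X by (rule genideal_ideal)
    show "0 \<in> Idl\<^bsub>R\<^esub> ?X"
      using I.zero_closed by (simp add: R_def)
    show "f + g \<in> Idl\<^bsub>R\<^esub> ?X" if "f \<in> Idl\<^bsub>R\<^esub> ?X" "g \<in> Idl\<^bsub>R\<^esub> ?X" for f g
      using I.a_closed[OF that] by (simp add: R_def)
    fix w and c :: 'k assume "w \<in> ?W"
    then obtain g t where w: "w = g + t" "g \<in> G" "t \<in> T"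
      by blast
    have "Poly_Mapping.single g 1 \<otimes>\<^bsub>R\<^esub> Poly_Mapping.single t c \<in> Idl\<^bsub>R\<^esub> ?X"
      using w genideal_self[OF X] by (intro I.I_r_closed) (auto simp: carr single_in_monomial_span)
    then show "Poly_Mapping.single w c \<in> Idl\<^bsub>R\<^esub> ?X"
      by (simp add: R_def mult_single w(1))
  qed
  have WT: "?W \<subseteq> T"
    using add assms(3) by blast
  have "ideal (monomial_span ?W) R"
  proof (rule idealI)
    show "subgroup (monomial_span ?W) (add_monoid R)"
    proof (rule group.subgroupI[OF a_group])
      show "monomial_span ?W \<subseteq> carrier (add_monoid R)"
        using WT by (simp add: carr monomial_span_subset_iff)
      show "monomial_span ?W \<noteq> ({} :: 'k laurent set)"
        by (auto simp: monomial_span_def intro!: exI[of _ 0])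
    next
      fix f :: "'k laurent" assume f: "f \<in> monomial_span ?W"
      then have "f \<in> carrier R"
        using WT by (auto simp: carr monomial_span_def)
      then have "\<ominus>\<^bsub>R\<^esub> f = - f"
        by (intro minus_equality) (auto simp: R_def)
      then show "inv\<^bsub>add_monoid R\<^esub> f \<in> monomial_span ?W"
        using f by (simp add: monomial_span_def a_inv_def)
    next
      fix f g :: "'k laurent" assume "f \<in> monomial_span ?W" "g \<in> monomial_span ?W"
      then show "f \<otimes>\<^bsub>add_monoid R\<^esub> g \<in> monomial_span ?W"
        by (simp add: R_def monomial_span_add)
    qed
  next
    fix f g :: "'k laurent" assume "f \<in> monomial_span ?W" "g \<in> carrier R"
    moreover have "{v + w | v w. v \<in> ?W \<and> w \<in> T} \<subseteq> ?W"
      using add by (auto simp only: mem_Collect_eq add.assoc) blast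
    ultimately have "f * g \<in> monomial_span ?W"
      using monomial_span_mult[of f ?W g T]
        monomial_span_subset_iff[of "{v + w | v w. v \<in> ?W \<and> w \<in> T}" ?W, where ?'k = 'k]
      by (auto simp only: carr)
    then show "f \<otimes>\<^bsub>R\<^esub> g \<in> monomial_span ?W" "g \<otimes>\<^bsub>R\<^esub> f \<in> monomial_span ?W"
      by (simp_all add: R_def mult.commute)
  qed (rule ring_axioms)
  moreover have "?X \<subseteq> monomial_span ?W"
    using zero by (force intro!: single_in_monomial_span)
  ultimately show "Idl\<^bsub>R\<^esub> ?X \<subseteq> monomial_span ?W"
    by (rule genideal_minimal)
qed

section \<open>The reduction number\<close>

context gap_set
begin

text \<open>The semigroup with integer coordinates, so that differences of exponents can be formed
  and tested for membership.\<close>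

abbreviation T :: "(int \<times> int) set" where
  "T \<equiv> map_prod int int ` assoc_semigroup \<alpha> A"

lemma T_iff: "(u, v) \<in> T \<longleftrightarrow> (\<exists>n x. x \<in> sumset A n \<and> u = int x \<and> v = int (n * \<alpha>) - int x)"
proof
  assume "(u, v) \<in> T"
  then obtain x y where "(x, y) \<in> assoc_semigroup \<alpha> A" "u = int x" "v = int y"
    by auto
  then show "\<exists>n x. x \<in> sumset A n \<and> u = int x \<and> v = int (n * \<alpha>) - int x"
    unfolding mem_assoc_semigroup_iff[OF A_le] by (metis add_diff_cancel_left' of_nat_add)
next
  assume "\<exists>n x. x \<in> sumset A n \<and> u = int x \<and> v = int (n * \<alpha>) - int x"
  then obtain n x where x: "x \<in> sumset A n" "u = int x" "v = int (n * \<alpha>) - int x"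
    by blast
  then have le: "x \<le> n * \<alpha>"
    using sumset_le[OF A_le] by blast
  then have "(x, n * \<alpha> - x) \<in> assoc_semigroup \<alpha> A"
    unfolding mem_assoc_semigroup_iff[OF A_le] using x(1) by (intro exI[of _ n]) auto
  then show "(u, v) \<in> T"
    using x le by (intro image_eqI[of _ _ "(x, n * \<alpha> - x)"]) auto
qed

text \<open>As \<alpha> is positive, a point determines its degree, which removes the existential
  quantifier of \<open>T_iff\<close>.\<close>

lemma T_degree_iff: "(int x, int (n * \<alpha>) - int x) \<in> T \<longleftrightarrow> x \<in> sumset A n"
  using q_less unfolding T_iff by auto

lemma T_nonneg: "(u, v) \<in> T \<Longrightarrow> 0 \<le> u \<and> 0 \<le> v"
  by auto

lemma T_full:
  assumes "0 \<le> u" "0 \<le> v" "u + v = int \<alpha> * j" "int N \<le> j"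
  shows "(u, v) \<in> T"
proof -
  define n where "n = nat j"
  have n: "j = int n" "N \<le> n"
    using assms(4) by (auto simp: n_def)
  have u: "u = int (nat u)"
    using assms(1) by simp
  have v: "v = int (n * \<alpha>) - u"
    using assms(3) n(1) by (simp add: algebra_simps)
  then have "nat u \<le> n * \<alpha>"
    using assms(1,2) by linarith
  then have "nat u \<in> sumset A n"
    using full_ge[OF n(2)] by (auto simp: full_def)
  then show ?thesis
    using T_degree_iff[of "nat u" n] u v by simp
qed

lemma T_add: "s \<in> T \<Longrightarrow> t \<in> T \<Longrightarrow> s + t \<in> T"
  using assoc_semigroup_add by (auto simp only: image_iff map_prod_int_add[symmetric])

lemma T_zero: "(0, 0) \<in> T"
  using T_degree_iff[of 0 0] by simp

lemma T_generator: "a \<in> A \<Longrightarrow> (int a, int \<alpha> - int a) \<in> T"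
  using T_degree_iff[of a 1] by simp

lemma T_ends: "{(int \<alpha>, 0), (0, int \<alpha>)} \<subseteq> T"
  using T_generator[OF high(3)] T_generator[OF zero_in] by simp

definition T_ge :: "nat \<Rightarrow> (int \<times> int) set" where
  "T_ge r = {w \<in> T. int (r * \<alpha>) \<le> fst w + snd w}"

lemma T_ge_iff:
  "(u, v) \<in> T_ge r \<longleftrightarrow> (\<exists>n x. r \<le> n \<and> x \<in> sumset A n \<and> u = int x \<and> v = int (n * \<alpha>) - int x)"
proof -
  have "int (r * \<alpha>) \<le> int (n * \<alpha>) \<longleftrightarrow> r \<le> n" for n
    using q_less by simp
  then show ?thesis
    unfolding T_ge_def mem_Collect_eq T_iff fst_conv snd_conv
    by (auto simp del: of_nat_mult of_nat_le_iff)
qed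

lemma T_ge_0: "T_ge 0 = T"
  using T_nonneg by (auto simp: T_ge_def)

text \<open>The semigroup is generated in degree 1: an element of degree above \<open>r\<close>
  splits off one generator and keeps degree at least \<open>r\<close>.\<close>

lemma T_ge_Suc: "{v + w | v w. v \<in> T_ge r \<and> w \<in> T_ge 1} = T_ge (Suc r)"
proof
  show "{v + w | v w. v \<in> T_ge r \<and> w \<in> T_ge 1} \<subseteq> T_ge (Suc r)"
  proof
    fix x assume "x \<in> {v + w | v w. v \<in> T_ge r \<and> w \<in> T_ge 1}"
    then obtain v w where vw: "x = v + w" "v \<in> T_ge r" "w \<in> T_ge 1"
      by blast
    then have "v + w \<in> T"
      by (intro T_add) (simp_all add: T_ge_def)
    with vw show "x \<in> T_ge (Suc r)"
      by (simp add: T_ge_def)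
  qed
  show "T_ge (Suc r) \<subseteq> {v + w | v w. v \<in> T_ge r \<and> w \<in> T_ge 1}"
  proof (safe)
    fix u v assume "(u, v) \<in> T_ge (Suc r)"
    then obtain n x where x: "Suc r \<le> n" "x \<in> sumset A n" "u = int x" "v = int (n * \<alpha>) - int x"
      unfolding T_ge_iff by blast
    then obtain m where n: "n = Suc m" "r \<le> m"
      by (cases n) auto
    obtain y a where y: "x = y + a" "y \<in> sumset A m" "a \<in> A"
      using x(2) unfolding n(1) by (rule sumset_Suc_E)
    have "(int y, int (m * \<alpha>) - int y) \<in> T_ge r"
      using y n T_ge_iff by blast
    moreover have "(int a, int \<alpha> - int a) \<in> T_ge 1"
      using T_generator[OF y(3)] by (simp add: T_ge_def)
    moreover have "(u, v) = (int y, int (m * \<alpha>) - int y) + (int a, int \<alpha> - int a)"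
      using x(3,4) y(1) n(1) by simp
    ultimately show "\<exists>v' w. (u, v) = v' + w \<and> v' \<in> T_ge r \<and> w \<in> T_ge 1"
      by blast
  qed
qed

section \<open>Powers of the maximal ideal and their products with the reduction ideal as exponent
  sets\<close>

lemma max_homogeneous_ideal_eq_span:
  "max_homogeneous_ideal (semigroup_ring (assoc_semigroup \<alpha> A)) =
    (monomial_span (T_ge 1) :: 'k::field laurent set)"
proof -
  have "(u, v) \<in> T_ge 1" if uv: "(u, v) \<in> T" "(u, v) \<noteq> (0, 0)" for u v
  proof -
    obtain n x where x: "x \<in> sumset A n" "u = int x" "v = int (n * \<alpha>) - int x"
      using uv(1) unfolding T_iff by blast
    with uv(2) have "1 \<le> n"
      by (cases n) auto
    with x show ?thesis
      unfolding T_ge_iff by blast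
  qed
  moreover have "(0, 0) \<notin> T_ge 1"
    using q_less by (simp add: T_ge_def)
  moreover have "T_ge 1 \<subseteq> T"
    by (auto simp only: T_ge_def)
  ultimately have "T_ge 1 = T - {(0, 0)}"
    by (intro equalityI subsetI) (blast, metis Diff_iff insertCI surj_pair)
  then show ?thesis
    by (auto simp: max_homogeneous_ideal_def monomial_span_def in_keys_iff simp del: One_nat_def)
qed

lemma max_homogeneous_ideal_pow:
  fixes R :: "'k::field laurent ring"
  assumes "R = semigroup_ring (assoc_semigroup \<alpha> A)"
  shows "max_homogeneous_ideal R [^]\<^bsub>ideals_set R\<^esub> r = monomial_span (T_ge r)"
proof (induction r)
  \<comment> \<open>The zeroth power is the unit of the monoid of ideals, that is, the whole
    ring.\<close>
  case 0
  then show ?case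
    by (simp add: ideals_set_def assms carrier_semigroup_ring T_ge_0 nat_pow_def)
next
  case (Suc r)
  have "max_homogeneous_ideal R [^]\<^bsub>ideals_set R\<^esub> Suc r =
      (max_homogeneous_ideal R [^]\<^bsub>ideals_set R\<^esub> r) \<cdot>\<^bsub>R\<^esub> max_homogeneous_ideal R"
    by (simp add: nat_pow_def ideals_set_def)
  then show ?case
    unfolding Suc.IH unfolding assms max_homogeneous_ideal_eq_span ideal_prod_monomial_span T_ge_Suc .
qed

text \<open>The exponents of \<qq> times the \<open>r\<close>-th power of \<mm>, by
  \<open>reduction_ideal_prod\<close>.\<close>

definition T_red :: "nat \<Rightarrow> (int \<times> int) set" where
  "T_red r = {g + w | g w. g \<in> {(int \<alpha>, 0), (0, int \<alpha>)} \<and> w \<in> T_ge r}"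

lemma reduction_ideal_prod:
  fixes R :: "'k::field laurent ring"
  assumes "R = semigroup_ring (assoc_semigroup \<alpha> A)"
  shows "reduction_ideal \<alpha> R \<cdot>\<^bsub>R\<^esub> (max_homogeneous_ideal R [^]\<^bsub>ideals_set R\<^esub> r) =
    monomial_span (T_red r)"
proof -
  let ?G = "{(int \<alpha>, 0), (0, int \<alpha>)}"
  have "reduction_ideal \<alpha> R = monomial_span {g + t | g t. g \<in> ?G \<and> t \<in> T}"
    using genideal_monomials[OF T_ends, where ?'k = 'k] by (simp add: reduction_ideal_def assms)
  then have "reduction_ideal \<alpha> R \<cdot>\<^bsub>R\<^esub> (max_homogeneous_ideal R [^]\<^bsub>ideals_set R\<^esub> r) =
      monomial_span {s + w | s w. s \<in> {g + t | g t. g \<in> ?G \<and> t \<in> T} \<and> w \<in> T_ge r}"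
    unfolding max_homogeneous_ideal_pow[OF assms] by (simp only: assms ideal_prod_monomial_span)
  \<comment> \<open>The summand from \<open>T\<close> contributed by the generated ideal is absorbed
    into \<open>T_ge r\<close>, because its degree is nonnegative.\<close>
  also have "{s + w | s w. s \<in> {g + t | g t. g \<in> ?G \<and> t \<in> T} \<and> w \<in> T_ge r} = T_red r"
  proof (intro equalityI subsetI)
    fix x assume "x \<in> {s + w | s w. s \<in> {g + t | g t. g \<in> ?G \<and> t \<in> T} \<and> w \<in> T_ge r}"
    then obtain s w where s: "x = s + w" "s \<in> {g + t | g t. g \<in> ?G \<and> t \<in> T}" "w \<in> T_ge r"
      by blast
    then obtain g t where "s = g + t" "g \<in> ?G" "t \<in> T"
      by blast
    with s have x: "x = g + (t + w)" "g \<in> ?G" "t \<in> T" "w \<in> T_ge r"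
      by (simp_all only: add.assoc)
    then have "0 \<le> fst t + snd t"
      using T_nonneg[of "fst t" "snd t"] by simp
    then have "t + w \<in> T_ge r"
      using x(3,4) T_add by (auto simp: T_ge_def simp del: of_nat_mult)
    then show "x \<in> T_red r"
      using x(1,2) unfolding T_red_def by blast
  next
    fix x assume "x \<in> T_red r"
    then obtain g w where x: "x = g + w" "g \<in> ?G" "w \<in> T_ge r"
      unfolding T_red_def by blast
    then have "x = (g + 0) + w" "g \<in> ?G" "w \<in> T_ge r"
      by simp_all
    moreover have "0 \<in> T"
      using T_zero by (simp add: zero_prod_def)
    ultimately have "g + 0 \<in> {g + t | g t. g \<in> ?G \<and> t \<in> T}"
      by (intro CollectI exI[of _ g] exI[of _ 0]) simp
    with \<open>x = (g + 0) + w\<close> \<open>w \<in> T_ge r\<close>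
    show "x \<in> {s + w | s w. s \<in> {g + t | g t. g \<in> ?G \<and> t \<in> T} \<and> w \<in> T_ge r}"
      by blast
  qed
  finally show ?thesis .
qed

text \<open>From an exponent of degree above \<open>N\<close>, one of \<open>(0, \<alpha>)\<close>
  and \<open>(\<alpha>, 0)\<close> can be subtracted within the quadrant; the result has degree at
  least \<open>N\<close>, where there are no holes.\<close>

lemma T_red_full: "T_ge (Suc N) = T_red N"
proof (intro equalityI subsetI; clarify)
  fix u v assume "(u, v) \<in> T_ge (Suc N)"
  then obtain n x where x: "Suc N \<le> n" "x \<in> sumset A n" "u = int x" "v = int (n * \<alpha>) - int x"
    unfolding T_ge_iff by blast
  then obtain m where n: "n = Suc m" "N \<le> m"
    by (cases n) auto
  have full: "full m"
    by (rule full_ge[OF n(2)])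
  show "(u, v) \<in> T_red N"
  proof (cases "x \<le> m * \<alpha>")
    case True
    then have "(u, v - int \<alpha>) \<in> T_ge N"
      unfolding T_ge_iff using x n full by (intro exI[of _ m] exI[of _ x]) (auto simp: full_def)
    moreover have "(u, v) = (0, int \<alpha>) + (u, v - int \<alpha>)"
      by simp
    ultimately show ?thesis
      unfolding T_red_def by blast
  next
    case False
    have "\<alpha> \<le> m * \<alpha>"
      using N_pos n(2) by simp
    then have "\<alpha> \<le> x"
      using False by linarith
    moreover have "x \<le> n * \<alpha>"
      by (rule sumset_le[OF A_le x(2)])
    ultimately have "(u - int \<alpha>, v) \<in> T_ge N"
      unfolding T_ge_iff using x n full
      by (intro exI[of _ m] exI[of _ "x - \<alpha>"]) (auto simp: full_def algebra_simps of_nat_diff)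
    moreover have "(u, v) = (int \<alpha>, 0) + (u - int \<alpha>, v)"
      by simp
    ultimately show ?thesis
      unfolding T_red_def by blast
  qed
next
  fix u v assume "(u, v) \<in> T_red N"
  then obtain g w where x: "(u, v) = g + w" "g \<in> {(int \<alpha>, 0), (0, int \<alpha>)}" "w \<in> T_ge N"
    unfolding T_red_def by blast
  then have "g \<in> T"
    using T_ends by blast
  then show "(u, v) \<in> T_ge (Suc N)"
    using x T_add by (auto simp: T_ge_def)
qed

text \<open>A single point of degree \<open>N\<close> serves for all \<open>r < N\<close>: it lies
  in \<open>T_ge (Suc r)\<close>, but subtracting either \<open>(\<alpha>, 0)\<close> or
  \<open>(0, \<alpha>)\<close> leaves \<open>T\<close>.\<close>

lemma T_red_not_full:
  assumes "r < N"
  shows "T_ge (Suc r) \<noteq> T_red r"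
proof
  assume eq: "T_ge (Suc r) = T_red r"
  \<comment> \<open>The first bound forbids subtracting \<open>(0, \<alpha>)\<close>, the third
    condition forbids \<open>(\<alpha>, 0)\<close>. The alternative \<open>x < \<alpha>\<close> is
    there because \<open>x - \<alpha>\<close> would truncate to 0, which lies in
    \<open>sumset A 0\<close>.\<close>
  obtain x where x: "(N - 1) * \<alpha> < x" "x \<le> N * \<alpha>" "x - \<alpha> \<notin> sumset A (N - 1) \<or> x < \<alpha>"
    "x \<in> sumset A N"
  proof (cases "N = 1")
    case True
    \<comment> \<open>A generator other than the two ends does it, here the one with first
      coordinate 1.\<close>
    then show ?thesis
      using that[of 1] one_in p_pos p_less q_less by simp
  next
    case False
    then obtain m where N: "N = Suc (Suc m)"
      using N_pos by (metis One_nat_def not0_implies_Suc not_less0)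
    \<comment> \<open>The hole has degree \<open>N - 1\<close>. Its shift by \<alpha> has degree
      \<open>N\<close>, where the sumset is full, and it exceeds \<open>(N - 1) * \<alpha>\<close>
      because the hole lies in the top block.\<close>
    then obtain x where "m * \<alpha> < x" "x \<le> (N - 1) * \<alpha>" "x \<notin> sumset A (N - 1)"
      using hole by auto
    then show ?thesis
      using that[of "x + \<alpha>"] subsetD[OF full_N[unfolded full_def], of "x + \<alpha>"] by (simp add: N)
  qed
  have "(int x, int (N * \<alpha>) - int x) \<in> T_ge (Suc r)"
    unfolding T_ge_iff using x assms by (intro exI[of _ N] exI[of _ x]) auto
  then have "(int x, int (N * \<alpha>) - int x) \<in> T_red r"
    by (simp only: eq)
  then obtain g w where gw: "(int x, int (N * \<alpha>) - int x) = g + w" "g \<in> {(int \<alpha>, 0), (0, int \<alpha>)}"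
    "w \<in> T"
    unfolding T_red_def T_ge_def by blast
  obtain m where N: "N = Suc m"
    using N_pos by (cases N) auto
  from gw(2) consider "g = (int \<alpha>, 0)" | "g = (0, int \<alpha>)"
    by blast
  then show False
  proof cases
    case 1
    then have w: "w = (int x - int \<alpha>, int (N * \<alpha>) - int x)"
      using gw(1) by (cases w) auto
    then have "\<alpha> \<le> x"
      using gw(3) T_nonneg by fastforce
    then have "w = (int (x - \<alpha>), int (m * \<alpha>) - int (x - \<alpha>))"
      using w N by (simp add: of_nat_diff)
    with gw(3) have "x - \<alpha> \<in> sumset A m"
      by (simp only: T_degree_iff)
    then show False
      using x(3) \<open>\<alpha> \<le> x\<close> N by simp
  next
    case 2
    then have w: "w = (int x, int (m * \<alpha>) - int x)"
      using gw(1) N by (cases w) auto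
    then have "int x \<le> int (m * \<alpha>)"
      using T_nonneg gw(3) by fastforce
    then show False
      using x(1) N by (simp del: of_nat_mult)
  qed
qed

lemma reduction_number_eq:
  fixes R :: "'k::field laurent ring"
  assumes "R = semigroup_ring (assoc_semigroup \<alpha> A)"
  shows "reduction_number \<alpha> R = N"
  unfolding reduction_number_def max_homogeneous_ideal_pow[OF assms]
    reduction_ideal_prod[OF assms, unfolded max_homogeneous_ideal_pow[OF assms]]
    monomial_span_eq_iff
proof (rule Least_equality)
  show "T_ge (N + 1) = T_red N"
    using T_red_full by simp
  show "N \<le> r" if "T_ge (r + 1) = T_red r" for r
    using that T_red_not_full[of r] by (cases "r < N") auto
qed

end

section \<open>Contractions of the Cech complex\<close>

definition cech_sign :: "nat set \<Rightarrow> nat \<Rightarrow> 'a::comm_ring_1" where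
  "cech_sign \<tau> a = (- 1) ^ card {b \<in> \<tau>. b < a}"

lemma cech_diff_sign:
  "cech_diff A c \<tau> = (if \<tau> \<subseteq> A then \<Sum>a\<in>\<tau>. cech_sign \<tau> a * c (\<tau> - {a}) else 0)"
  by (simp add: cech_diff_def cech_sign_def)

lemma cech_sign_square: "cech_sign \<tau> a * cech_sign \<tau> a = (1 :: 'a::comm_ring_1)"
  by (simp add: cech_sign_def power_add[symmetric])

lemma cech_sign_remove_self: "cech_sign (\<tau> - {a}) a = cech_sign \<tau> a"
  unfolding cech_sign_def by (intro arg_cong[of _ _ "\<lambda>X. (- 1) ^ card X"]) auto

lemma cech_sign_remove:
  assumes "finite \<tau>" "b \<in> \<tau>"
  shows "cech_sign \<tau> a = (if b < a then - 1 else 1) * (cech_sign (\<tau> - {b}) a :: 'a::comm_ring_1)"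
proof (cases "b < a")
  case True
  then have "{x \<in> \<tau>. x < a} = insert b {x \<in> \<tau> - {b}. x < a}"
    using assms(2) by auto
  then show ?thesis
    using assms(1) True by (simp add: cech_sign_def)
next
  case False
  then have "{x \<in> \<tau>. x < a} = {x \<in> \<tau> - {b}. x < a}"
    by auto
  then show ?thesis
    using False by (simp add: cech_sign_def)
qed

text \<open>Removing one index flips the sign of the other exactly when the removed one is smaller,
  so exactly one of the two orders of removal picks up a sign.\<close>

lemma cech_sign_swap:
  assumes "finite \<tau>" "a \<in> \<tau>" "b \<in> \<tau>" "a \<noteq> b"
  shows "cech_sign \<tau> a * cech_sign (\<tau> - {a}) b =
    - (cech_sign \<tau> b * cech_sign (\<tau> - {b}) a :: 'a::comm_ring_1)"
  using assms(4) cech_sign_remove[OF assms(1,3), of a, where ?'a = 'a]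
    cech_sign_remove[OF assms(1,2), of b, where ?'a = 'a]
  by (cases "a < b") (simp_all add: mult.commute)

text \<open>Stated for arbitrary families, so that it also applies in
  \<open>single_coboundary\<close>, where the family need not be a cochain.\<close>

lemma cech_diff_diff:
  fixes c :: "nat set \<Rightarrow> 'a::comm_ring_1"
  assumes "finite A"
  shows "cech_diff A (cech_diff A c) = (\<lambda>_. 0)"
proof
  fix \<tau>
  show "cech_diff A (cech_diff A c) \<tau> = 0"
  proof (cases "\<tau> \<subseteq> A")
    case True
    then have fin: "finite \<tau>"
      using assms finite_subset by blast
    define g where "g a b = cech_sign \<tau> a * cech_sign (\<tau> - {a}) b * c (\<tau> - {a} - {b})" for a b
    have swap: "g a b = - g b a" if "a \<in> \<tau>" "b \<in> \<tau>" "a \<noteq> b" for a b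
      using cech_sign_swap[OF fin that, where ?'a = 'a]
      by (simp add: g_def Diff_insert[symmetric] insert_commute)
    have "cech_diff A (cech_diff A c) \<tau> = (\<Sum>a\<in>\<tau>. cech_sign \<tau> a * cech_diff A c (\<tau> - {a}))"
      using True by (simp add: cech_diff_sign)
    also have "\<dots> = (\<Sum>a\<in>\<tau>. \<Sum>b\<in>\<tau> - {a}. g a b)"
      using True
      by (intro sum.cong refl) (auto simp: cech_diff_sign sum_distrib_left g_def mult.assoc)
    \<comment> \<open>The two halves \<open>b < a\<close> and \<open>a < b\<close> cancel term by
      term. Antisymmetry of the whole sum would only show that it equals its own negative, which is
      too weak in characteristic two.\<close>
    also have "\<dots> = (\<Sum>a\<in>\<tau>. (\<Sum>b | b \<in> \<tau> \<and> b < a. g a b) + (\<Sum>b | b \<in> \<tau> \<and> a < b. g a b))"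
      using fin by (intro sum.cong refl) (subst sum.union_disjoint[symmetric], auto intro: sum.cong)
    also have "\<dots> = (\<Sum>a\<in>\<tau>. \<Sum>b | b \<in> \<tau> \<and> b < a. g a b) + (\<Sum>a\<in>\<tau>. \<Sum>b | b \<in> \<tau> \<and> a < b. g a b)"
      by (rule sum.distrib)
    also have "(\<Sum>a\<in>\<tau>. \<Sum>b | b \<in> \<tau> \<and> a < b. g a b) = (\<Sum>b\<in>\<tau>. \<Sum>a | a \<in> \<tau> \<and> a < b. g a b)"
      by (rule sum.swap_restrict[OF fin fin])
    also have "\<dots> = - (\<Sum>b\<in>\<tau>. \<Sum>a | a \<in> \<tau> \<and> a < b. g b a)"
      unfolding sum_negf[symmetric] by (intro sum.cong refl swap) auto
    finally show ?thesis by simp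
  qed (simp add: cech_diff_sign)
qed

text \<open>The contracting homotopy of a full simplex, viewed as a cone with apex
  \<open>a\<close>.\<close>

definition cech_contract :: "nat \<Rightarrow> (nat set \<Rightarrow> 'a::comm_ring_1) \<Rightarrow> nat set \<Rightarrow> 'a" where
  "cech_contract a c \<sigma> = (if a \<in> \<sigma> then 0 else cech_sign \<sigma> a * c (insert a \<sigma>))"

text \<open>The homotopy identity dh + hd = id, evaluated on a cocycle. If
  \<open>a \<in> \<sigma>\<close>, only the term that removes \<open>a\<close> survives; otherwise
  the cocycle condition on \<open>insert a \<sigma>\<close> expresses \<open>c \<sigma>\<close>
  through the remaining terms.\<close>

lemma cech_diff_contract:
  fixes c :: "nat set \<Rightarrow> 'a::comm_ring_1"
  assumes "finite A" "a \<in> A" and supp: "\<And>\<sigma>. \<not> \<sigma> \<subseteq> A \<Longrightarrow> c \<sigma> = 0"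
    and cocycle: "cech_diff A c = (\<lambda>_. 0)"
  shows "cech_diff A (cech_contract a c) = c"
proof
  fix \<sigma>
  show "cech_diff A (cech_contract a c) \<sigma> = c \<sigma>"
  proof (cases "\<sigma> \<subseteq> A")
    case sub: True
    then have fin: "finite \<sigma>"
      using assms(1) finite_subset by blast
    have eq: "cech_diff A (cech_contract a c) \<sigma> =
        (\<Sum>b\<in>\<sigma>. cech_sign \<sigma> b * cech_contract a c (\<sigma> - {b}))"
      using sub by (simp add: cech_diff_sign)
    show ?thesis
    proof (cases "a \<in> \<sigma>")
      case True
      then have "(\<Sum>b\<in>\<sigma>. cech_sign \<sigma> b * cech_contract a c (\<sigma> - {b})) =
          (\<Sum>b\<in>{a}. cech_sign \<sigma> b * cech_contract a c (\<sigma> - {b}))"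
        using fin by (intro sum.mono_neutral_right) (auto simp: cech_contract_def)
      also have "\<dots> = c \<sigma>"
        using True
        by (simp add: cech_contract_def cech_sign_remove_self insert_absorb mult.assoc[symmetric]
            cech_sign_square)
      finally show ?thesis
        using eq by simp
    next
      case False
      have rm: "insert a \<sigma> - {a} = \<sigma>"
        using False by simp
      have "0 = cech_sign \<sigma> a * cech_diff A c (insert a \<sigma>)"
        by (simp add: cocycle)
      also have "\<dots> = cech_sign \<sigma> a * (cech_sign (insert a \<sigma>) a * c \<sigma> +
          (\<Sum>b\<in>\<sigma>. cech_sign (insert a \<sigma>) b * c (insert a \<sigma> - {b})))"
        using sub assms(2) fin False by (simp add: cech_diff_sign)
      also have "cech_sign (insert a \<sigma>) a = (cech_sign \<sigma> a :: 'a)"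
        using cech_sign_remove_self[of "insert a \<sigma>" a] rm by metis
      also have "cech_sign \<sigma> a * (cech_sign \<sigma> a * c \<sigma> +
            (\<Sum>b\<in>\<sigma>. cech_sign (insert a \<sigma>) b * c (insert a \<sigma> - {b}))) =
          c \<sigma> + (\<Sum>b\<in>\<sigma>. cech_sign \<sigma> a * cech_sign (insert a \<sigma>) b * c (insert a \<sigma> - {b}))"
        by (simp add: distrib_left sum_distrib_left mult.assoc[symmetric] cech_sign_square)
      also have "(\<Sum>b\<in>\<sigma>. cech_sign \<sigma> a * cech_sign (insert a \<sigma>) b * c (insert a \<sigma> - {b})) =
          (\<Sum>b\<in>\<sigma>. - (cech_sign \<sigma> b * cech_contract a c (\<sigma> - {b})))"
      proof (intro sum.cong refl)
        fix b assume b: "b \<in> \<sigma>"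
        then have ab: "a \<noteq> b" "insert a \<sigma> - {b} = insert a (\<sigma> - {b})"
          using False by auto
        have "cech_sign (insert a \<sigma> - {b}) a = (cech_sign (insert a \<sigma> - {b} - {a}) a :: 'a)"
          by (rule cech_sign_remove_self[symmetric])
        also have "insert a \<sigma> - {b} - {a} = \<sigma> - {b}"
          using False by auto
        finally have *: "cech_sign \<sigma> a * cech_sign \<sigma> b =
            - (cech_sign (insert a \<sigma>) b * cech_sign (\<sigma> - {b}) a :: 'a)"
          using cech_sign_swap[of "insert a \<sigma>" a b, where ?'a = 'a] fin b ab(1) rm
            cech_sign_remove_self[of "insert a \<sigma>" a, where ?'a = 'a]
          by simp
        have "cech_sign \<sigma> b * cech_sign (\<sigma> - {b}) a =
            cech_sign \<sigma> a * (cech_sign \<sigma> a * cech_sign \<sigma> b) * (cech_sign (\<sigma> - {b}) a :: 'a)"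
          by (simp add: mult.assoc[symmetric] cech_sign_square)
        also have "\<dots> = - (cech_sign \<sigma> a * cech_sign (insert a \<sigma>) b *
            (cech_sign (\<sigma> - {b}) a * cech_sign (\<sigma> - {b}) a))"
          unfolding * by (simp add: mult.assoc)
        finally have "cech_sign \<sigma> b * cech_sign (\<sigma> - {b}) a =
            - (cech_sign \<sigma> a * cech_sign (insert a \<sigma>) b :: 'a)"
          by (simp add: cech_sign_square)
        then show "cech_sign \<sigma> a * cech_sign (insert a \<sigma>) b * c (insert a \<sigma> - {b}) =
            - (cech_sign \<sigma> b * cech_contract a c (\<sigma> - {b}))"
          using False by (simp add: cech_contract_def ab(2) mult.assoc[symmetric])
      qed
      finally show ?thesis
        unfolding eq by (simp add: sum_negf)
    qed
  next
    case False
    then show ?thesis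
      by (simp add: cech_diff_sign supp)
  qed
qed

text \<open>The differential acts on each exponent separately, so the complex can be studied one
  lattice point at a time, with coefficients in the field.\<close>

lemma lookup_cech_diff:
  "Poly_Mapping.lookup (cech_diff A c \<tau> :: 'k::field laurent) w =
    cech_diff A (\<lambda>\<sigma>. Poly_Mapping.lookup (c \<sigma>) w) \<tau>"
proof -
  have "Poly_Mapping.lookup (cech_sign \<tau> a * f :: 'k laurent) w =
      cech_sign \<tau> a * Poly_Mapping.lookup f w" for a f
    unfolding cech_sign_def by (cases "even (card {b \<in> \<tau>. b < a})") auto
  then show ?thesis
    by (simp add: cech_diff_sign lookup_sum)
qed

lemma cech_diff_add:
  "cech_diff A (\<lambda>\<sigma>. c \<sigma> + d \<sigma>) = (\<lambda>\<tau>. cech_diff A c \<tau> + cech_diff A d \<tau>)"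
  by (auto simp: cech_diff_def distrib_left sum.distrib)

lemma cech_diff_minus: "cech_diff A (\<lambda>\<sigma>. - c \<sigma>) = (\<lambda>\<tau>. - cech_diff A c \<tau>)"
  by (auto simp: cech_diff_def sum_negf)

lemma cech_diff_zero: "cech_diff A (\<lambda>_. 0) = (\<lambda>_. 0)"
  by (auto simp: cech_diff_def)

section \<open>The regularity\<close>

text \<open>The unit of the quotient is the set of coboundaries itself, and a coset equals it
  exactly if its representative is a coboundary. The subgroup properties this takes are assumed here
  and checked in \<open>piece_trivial_iff\<close>.\<close>

lemma cech_piece_trivial_iff:
  fixes R :: "'k::field laurent ring"
  assumes closed: "\<And>c d. c \<in> cech_coboundaries R A (generator \<alpha>) i \<Longrightarrow>
      d \<in> cech_coboundaries R A (generator \<alpha>) i \<Longrightarrow>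
      (\<lambda>\<sigma>. c \<sigma> + d \<sigma>) \<in> cech_coboundaries R A (generator \<alpha>) i"
    and minus: "\<And>c. c \<in> cech_coboundaries R A (generator \<alpha>) i \<Longrightarrow>
      (\<lambda>\<sigma>. - c \<sigma>) \<in> cech_coboundaries R A (generator \<alpha>) i"
    and zero: "(\<lambda>_. 0) \<in> cech_coboundaries R A (generator \<alpha>) i"
      "(\<lambda>_. 0) \<in> carrier (cech_cocycles R A (generator \<alpha>) i)"
  shows "local_cohomology_piece \<alpha> A R i j = {\<one>\<^bsub>local_cohomology R A (generator \<alpha>) i\<^esub>} \<longleftrightarrow>
    (\<forall>z \<in> carrier (cech_cocycles R A (generator \<alpha>) i). (\<forall>\<sigma>. homogeneous \<alpha> j (z \<sigma>)) \<longrightarrow>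
      z \<in> cech_coboundaries R A (generator \<alpha>) i)"
    (is "_ \<longleftrightarrow> (\<forall>z \<in> carrier ?Z. ?h z \<longrightarrow> z \<in> ?B)")
proof -
  have coset: "?B #>\<^bsub>?Z\<^esub> z = {(\<lambda>\<sigma>. b \<sigma> + z \<sigma>) | b. b \<in> ?B}" for z
    by (auto simp: r_coset_def cech_cocycles_def)
  have eq: "?B #>\<^bsub>?Z\<^esub> z = ?B \<longleftrightarrow> z \<in> ?B" for z
  proof
    assume "?B #>\<^bsub>?Z\<^esub> z = ?B"
    moreover have "z \<in> ?B #>\<^bsub>?Z\<^esub> z"
      unfolding coset using zero(1) by (intro CollectI exI[of _ "\<lambda>_. 0"]) simp
    ultimately show "z \<in> ?B"
      by simp
  next
    assume z: "z \<in> ?B"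
    show "?B #>\<^bsub>?Z\<^esub> z = ?B"
    proof
      show "?B #>\<^bsub>?Z\<^esub> z \<subseteq> ?B"
        unfolding coset by (intro subsetI, elim CollectE exE conjE) (simp only: closed z)
      show "?B \<subseteq> ?B #>\<^bsub>?Z\<^esub> z"
      proof
        fix b assume "b \<in> ?B"
        then have "(\<lambda>\<sigma>. b \<sigma> + - z \<sigma>) \<in> ?B"
          by (intro closed minus z)
        then show "b \<in> ?B #>\<^bsub>?Z\<^esub> z"
          unfolding coset by (intro CollectI exI[of _ "\<lambda>\<sigma>. b \<sigma> + - z \<sigma>"]) simp
      qed
    qed
  qed
  have one: "\<one>\<^bsub>local_cohomology R A (generator \<alpha>) i\<^esub> = ?B"
    by (simp add: local_cohomology_def FactGroup_def)
  \<comment> \<open>Equality with a singleton also demands that the piece be nonempty; it contains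
    the class of zero.\<close>
  have singleton_iff: "P = {b} \<longleftrightarrow> (\<forall>C \<in> P. C = b)" if "c \<in> P" for P :: "'c set" and b c
    using that by auto
  have "?h (\<lambda>_. 0)"
    by (simp add: homogeneous_def)
  with zero have "?B #>\<^bsub>?Z\<^esub> (\<lambda>_. 0) \<in> local_cohomology_piece \<alpha> A R i j"
    unfolding local_cohomology_piece_def by blast
  then have "local_cohomology_piece \<alpha> A R i j = {?B} \<longleftrightarrow>
      (\<forall>C \<in> local_cohomology_piece \<alpha> A R i j. C = ?B)"
    by (rule singleton_iff)
  also have "\<dots> \<longleftrightarrow> (\<forall>z \<in> carrier ?Z. ?h z \<longrightarrow> ?B #>\<^bsub>?Z\<^esub> z = ?B)"
    unfolding local_cohomology_piece_def by blast
  finally show ?thesis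
    unfolding one eq .
qed

section \<open>Localizations and Cech cochains in terms of exponents\<close>

context gap_set
begin

abbreviation R :: "'k::field laurent ring" where
  "R \<equiv> semigroup_ring (assoc_semigroup \<alpha> A)"

definition exps :: "nat set \<Rightarrow> int \<times> int" where
  "exps \<sigma> = (\<Sum>a\<in>\<sigma>. int a, \<Sum>a\<in>\<sigma>. int \<alpha> - int a)"

text \<open>The exponents of the monomials in the localization of \<open>K[S]\<close> at the product over \<open>\<sigma>\<close>.\<close>
definition loc :: "nat set \<Rightarrow> (int \<times> int) set" where
  "loc \<sigma> = {w. \<exists>n. (fst w + int n * fst (exps \<sigma>), snd w + int n * snd (exps \<sigma>)) \<in> T}"

lemma finite_A: "finite A"
  using A_le finite_subset by blast

lemma prod_generator:
  "finite \<sigma> \<Longrightarrow> (\<Prod>a\<in>\<sigma>. generator \<alpha> a) = (Poly_Mapping.single (exps \<sigma>) 1 :: 'k::field laurent)"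
  by (induction \<sigma> rule: finite_induct)
    (simp_all add: exps_def generator_def mult_single zero_prod_def[symmetric])

lemma single_power:
  "(Poly_Mapping.single e 1 :: 'k::field laurent) ^ n =
    Poly_Mapping.single (int n * fst e, int n * snd e) 1"
  by (induction n) (simp_all add: mult_single zero_prod_def[symmetric] distrib_right prod_eq_iff
      plus_prod_def)

lemma exps_in_T:
  assumes "\<sigma> \<subseteq> A"
  shows "exps \<sigma> \<in> T"
proof -
  have "finite \<sigma>"
    using assms finite_A finite_subset by blast
  then show ?thesis
    using assms
  proof (induction \<sigma> rule: finite_induct)
    case empty
    then show ?case using T_zero by (simp add: exps_def)
  next
    case (insert a \<sigma>)
    then have "(int a, int \<alpha> - int a) + exps \<sigma> \<in> T"
      by (intro T_add T_generator) blast+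
    moreover have "exps (insert a \<sigma>) = (int a, int \<alpha> - int a) + exps \<sigma>"
      using insert(1,2) by (simp add: exps_def)
    ultimately show ?case
      by (simp only:)
  qed
qed

lemma exps_multiple_in_T: "\<sigma> \<subseteq> A \<Longrightarrow> (int n * fst (exps \<sigma>), int n * snd (exps \<sigma>)) \<in> T"
proof (induction n)
  case (Suc n)
  then have "(int n * fst (exps \<sigma>), int n * snd (exps \<sigma>)) + exps \<sigma> \<in> T"
    by (intro T_add exps_in_T)
  moreover have "(int n * fst (exps \<sigma>), int n * snd (exps \<sigma>)) + exps \<sigma> =
      (int (Suc n) * fst (exps \<sigma>), int (Suc n) * snd (exps \<sigma>))"
    by (cases "exps \<sigma>") (simp add: distrib_right)
  ultimately show ?case
    by (simp only:)
qed (use T_zero in simp)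

lemma span_T_mult:
  "f \<in> monomial_span T \<Longrightarrow> g \<in> monomial_span T \<Longrightarrow> f * g \<in> (monomial_span T :: 'k::field laurent set)"
proof -
  assume "f \<in> monomial_span T" "g \<in> monomial_span T"
  then have "f * g \<in> monomial_span {v + w | v w. v \<in> T \<and> w \<in> T}"
    by (rule monomial_span_mult)
  moreover have "{v + w | v w. v \<in> T \<and> w \<in> T} \<subseteq> T"
    using T_add by blast
  ultimately show ?thesis
    using monomial_span_subset_iff by blast
qed

text \<open>Multiplying by a power of a monomial only shifts exponents, so the localization is again
  spanned by monomials.\<close>

lemma localization_eq:
  assumes "\<sigma> \<subseteq> A"
  shows "localization R (\<Prod>a\<in>\<sigma>. generator \<alpha> a) = (monomial_span (loc \<sigma>) :: 'k::field laurent set)"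
proof
  let ?e = "exps \<sigma>" and ?f = "\<lambda>n. Poly_Mapping.single (int n * fst (exps \<sigma>), int n * snd (exps \<sigma>)) 1"
  have fin: "finite \<sigma>"
    using assms finite_A finite_subset by blast
  have L: "localization R (\<Prod>a\<in>\<sigma>. generator \<alpha> a) =
      {x :: 'k laurent. \<exists>n. ?f n * x \<in> monomial_span T}"
    by (simp only: localization_def prod_generator[OF fin] single_power carrier_semigroup_ring)
  have fT: "?f n \<in> (monomial_span T :: 'k laurent set)" for n
    using exps_multiple_in_T[OF assms] by (rule single_in_monomial_span)
  show "localization R (\<Prod>a\<in>\<sigma>. generator \<alpha> a) \<subseteq> (monomial_span (loc \<sigma>) :: 'k laurent set)"
  proof
    fix x :: "'k laurent" assume "x \<in> localization R (\<Prod>a\<in>\<sigma>. generator \<alpha> a)"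
    then obtain n where n: "?f n * x \<in> monomial_span T"
      unfolding L by blast
    have "x = Poly_Mapping.single (- (int n * fst ?e), - (int n * snd ?e)) 1 * (?f n * x)"
      by (simp add: mult.assoc[symmetric] mult_single zero_prod_def[symmetric])
    also have "\<dots> \<in> monomial_span
        {v + w | v w. v \<in> {(- (int n * fst ?e), - (int n * snd ?e))} \<and> w \<in> T}"
      using n by (intro monomial_span_mult single_in_monomial_span) auto
    finally have x: "Poly_Mapping.keys x \<subseteq>
        {v + w | v w. v \<in> {(- (int n * fst ?e), - (int n * snd ?e))} \<and> w \<in> T}"
      by (simp only: monomial_span_def mem_Collect_eq)
    have "Poly_Mapping.keys x \<subseteq> loc \<sigma>"
    proof
      fix u assume "u \<in> Poly_Mapping.keys x"
      then obtain w where "u = (- (int n * fst ?e), - (int n * snd ?e)) + w" "w \<in> T"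
        using x by blast
      then show "u \<in> loc \<sigma>"
        unfolding loc_def by (intro CollectI exI[of _ n]) (cases w, simp)
    qed
    then show "x \<in> monomial_span (loc \<sigma>)"
      by (simp add: monomial_span_def)
  qed
  show "(monomial_span (loc \<sigma>) :: 'k laurent set) \<subseteq> localization R (\<Prod>a\<in>\<sigma>. generator \<alpha> a)"
    unfolding L
  proof (rule monomial_span_subsetI)
    show "0 \<in> {x :: 'k laurent. \<exists>n. ?f n * x \<in> monomial_span T}"
      by (simp add: monomial_span_def)
  next
    fix x y :: "'k laurent"
    assume "x \<in> {x. \<exists>n. ?f n * x \<in> monomial_span T}" "y \<in> {x. \<exists>n. ?f n * x \<in> monomial_span T}"
    then obtain m n where mn: "?f m * x \<in> monomial_span T" "?f n * y \<in> monomial_span T"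
      by blast
    \<comment> \<open>The two fractions are brought to a common denominator.\<close>
    have "?f (m + n) * (x + y) = ?f n * (?f m * x) + ?f m * (?f n * y)"
      by (simp add: mult.assoc[symmetric] mult_single distrib_left distrib_right add.commute)
    also have "\<dots> \<in> monomial_span T"
      by (intro monomial_span_add span_T_mult mn fT)
    finally show "x + y \<in> {x. \<exists>n. ?f n * x \<in> monomial_span T}"
      by blast
  next
    fix w and c :: 'k assume "w \<in> loc \<sigma>"
    then obtain n where "(fst w + int n * fst ?e, snd w + int n * snd ?e) \<in> T"
      unfolding loc_def mem_Collect_eq by (rule exE)
    then have "(Poly_Mapping.single (fst w + int n * fst ?e, snd w + int n * snd ?e) c :: 'k laurent)
        \<in> monomial_span T"
      by (rule single_in_monomial_span)
    moreover have "Poly_Mapping.single (fst w + int n * fst ?e, snd w + int n * snd ?e) c =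
        ?f n * (Poly_Mapping.single w c :: 'k laurent)"
      by (cases w) (simp add: mult_single add.commute)
    ultimately have "?f n * (Poly_Mapping.single w c :: 'k laurent) \<in> monomial_span T"
      by (simp only:)
    then show "Poly_Mapping.single w c \<in> {x :: 'k laurent. \<exists>n. ?f n * x \<in> monomial_span T}"
      by blast
  qed
qed

lemma cech_cochains_iff:
  "c \<in> cech_cochains (R :: 'k::field laurent ring) A (generator \<alpha>) i \<longleftrightarrow>
    (\<forall>\<sigma>. if \<sigma> \<subseteq> A \<and> card \<sigma> = i then Poly_Mapping.keys (c \<sigma>) \<subseteq> loc \<sigma> else c \<sigma> = 0)"
  by (auto simp: cech_cochains_def localization_eq monomial_span_def)

lemma cech_cochains_add:
  assumes "c \<in> cech_cochains (R :: 'k::field laurent ring) A (generator \<alpha>) i"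
    "d \<in> cech_cochains R A (generator \<alpha>) i"
  shows "(\<lambda>\<sigma>. c \<sigma> + d \<sigma>) \<in> cech_cochains R A (generator \<alpha>) i"
  unfolding cech_cochains_iff
proof
  fix \<sigma>
  show "if \<sigma> \<subseteq> A \<and> card \<sigma> = i then Poly_Mapping.keys (c \<sigma> + d \<sigma>) \<subseteq> loc \<sigma> else c \<sigma> + d \<sigma> = 0"
    using assms[unfolded cech_cochains_iff, THEN spec, of \<sigma>] Poly_Mapping.keys_add[of "c \<sigma>" "d \<sigma>"]
    by (auto split: if_splits)
qed

lemma piece_trivial_iff:
  "local_cohomology_piece \<alpha> A R i j =
      {\<one>\<^bsub>local_cohomology (R :: 'k::field laurent ring) A (generator \<alpha>) i\<^esub>} \<longleftrightarrow>
    (\<forall>z \<in> carrier (cech_cocycles (R :: 'k laurent ring) A (generator \<alpha>) i).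
      (\<forall>\<sigma>. homogeneous \<alpha> j (z \<sigma>)) \<longrightarrow> z \<in> cech_coboundaries R A (generator \<alpha>) i)"
proof (rule cech_piece_trivial_iff)
  let ?C = "cech_cochains (R :: 'k laurent ring) A (generator \<alpha>)"
  let ?B = "cech_coboundaries (R :: 'k laurent ring) A (generator \<alpha>) i"
  have zero: "(\<lambda>_. 0) \<in> ?C k" for k
    by (simp add: cech_cochains_iff)
  then show "(\<lambda>_. 0) \<in> carrier (cech_cocycles (R :: 'k laurent ring) A (generator \<alpha>) i)"
    by (simp add: cech_cocycles_def cech_diff_zero)
  show "(\<lambda>_. 0) \<in> ?B"
    using zero[of "i - 1"]
    by (auto simp: cech_coboundaries_def cech_diff_zero intro: image_eqI[of _ _ "\<lambda>_. 0"])
  have B: "?B = cech_diff A ` ?C (i - 1)" if "i \<noteq> 0"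
    using that by (simp add: cech_coboundaries_def)
  show "(\<lambda>\<sigma>. c \<sigma> + d \<sigma>) \<in> ?B" if cd: "c \<in> ?B" "d \<in> ?B" for c d
  proof (cases "i = 0")
    case True
    then show ?thesis using cd by (simp add: cech_coboundaries_def)
  next
    case False
    obtain c' d' where *: "c' \<in> ?C (i - 1)" "d' \<in> ?C (i - 1)"
      "c = cech_diff A c'" "d = cech_diff A d'"
      using cd unfolding B[OF False] by blast
    then show ?thesis
      unfolding B[OF False] using cech_cochains_add[OF *(1,2)]
      by (intro image_eqI[of _ _ "\<lambda>\<sigma>. c' \<sigma> + d' \<sigma>"]) (simp_all only: cech_diff_add)
  qed
  show "(\<lambda>\<sigma>. - c \<sigma>) \<in> ?B" if c: "c \<in> ?B" for c
  proof (cases "i = 0")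
    case True
    then show ?thesis using c by (simp add: cech_coboundaries_def)
  next
    case False
    obtain c' where c': "c' \<in> ?C (i - 1)" "c = cech_diff A c'"
      using c unfolding B[OF False] by blast
    then have "(\<lambda>\<sigma>. - c' \<sigma>) \<in> ?C (i - 1)"
      unfolding cech_cochains_iff by simp
    then show ?thesis
      unfolding B[OF False] using c'(2)
      by (intro image_eqI[of _ _ "\<lambda>\<sigma>. - c' \<sigma>"]) (simp_all only: cech_diff_minus)
  qed
qed

lemma loc_empty: "loc {} = T"
  by (auto simp: loc_def exps_def)

text \<open>The generator for 0 has exponent \<open>(0, \<alpha>)\<close>, so inverting it leaves
  first exponents untouched; symmetrically for \<alpha>.\<close>

lemma loc_zero: "w \<in> loc {0} \<Longrightarrow> 0 \<le> fst w" and loc_alpha: "w \<in> loc {\<alpha>} \<Longrightarrow> 0 \<le> snd w"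
  by (auto simp: loc_def exps_def dest!: T_nonneg)

text \<open>For \<open>\<sigma> \<noteq> {}\<close> the finite complement of \<open>S\<close> is irrelevant; only the sign conditions remain.\<close>
lemma locI:
  assumes \<sigma>: "\<sigma> \<subseteq> A" "\<sigma> \<noteq> {}" and deg: "fst w + snd w = int \<alpha> * j"
    and fst: "0 \<le> fst w \<or> (\<exists>a\<in>\<sigma>. a \<noteq> 0)" and snd: "0 \<le> snd w \<or> (\<exists>a\<in>\<sigma>. a \<noteq> \<alpha>)"
  shows "w \<in> loc \<sigma>"
proof -
  have fin: "finite \<sigma>"
    using \<sigma>(1) finite_A finite_subset by blast
  define e1 where "e1 = (\<Sum>a\<in>\<sigma>. int a)"
  define e2 where "e2 = (\<Sum>a\<in>\<sigma>. int \<alpha> - int a)"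
  have le: "a \<le> \<alpha>" if "a \<in> \<sigma>" for a
    using that \<sigma>(1) A_le by auto
  have nonneg: "0 \<le> e1" "0 \<le> e2"
    using le by (auto simp: e1_def e2_def intro!: sum_nonneg)
  have pos1: "0 \<le> fst w \<or> 1 \<le> e1"
  proof (cases "0 \<le> fst w")
    case False
    then obtain a where "a \<in> \<sigma>" "a \<noteq> 0"
      using fst by blast
    then have "0 < e1"
      unfolding e1_def using fin by (intro sum_pos2[of _ a]) auto
    then show ?thesis by simp
  qed simp
  have pos2: "0 \<le> snd w \<or> 1 \<le> e2"
  proof (cases "0 \<le> snd w")
    case False
    then obtain a where "a \<in> \<sigma>" "a \<noteq> \<alpha>"
      using snd by blast
    then have "0 < e2"
      unfolding e2_def using fin le by (intro sum_pos2[of _ a]) (auto simp: nat_less_le)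
    then show ?thesis by simp
  qed simp
  \<comment> \<open>Large enough for all demands of \<open>T_full\<close>: a negative coordinate
    gains at least 1 per step, which makes it nonnegative after \<open>n\<close> steps, and the
    degree grows by \<open>card \<sigma> \<ge> 1\<close> per step, which lifts it to
    \<open>N\<close>.\<close>
  define n where "n = nat (\<bar>fst w\<bar> + \<bar>snd w\<bar> + \<bar>j\<bar>) + N"
  have n: "\<bar>fst w\<bar> \<le> int n" "\<bar>snd w\<bar> \<le> int n" "\<bar>j\<bar> + int N \<le> int n"
    unfolding n_def by linarith+
  have ge: "0 \<le> x + int n * e" if "0 \<le> x \<or> 1 \<le> e" "0 \<le> e" "\<bar>x\<bar> \<le> int n" for x e
  proof (cases "0 \<le> x")
    case False
    then have "int n * 1 \<le> int n * e"
      using that by (intro mult_left_mono) auto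
    then show ?thesis using that(3) by linarith
  qed (use that in simp)
  have sum: "e1 + e2 = int \<alpha> * int (card \<sigma>)"
    by (simp add: e1_def e2_def sum.distrib[symmetric] mult.commute)
  have "(fst w + int n * e1, snd w + int n * e2) \<in> T"
  proof (rule T_full)
    show "0 \<le> fst w + int n * e1"
      using ge pos1 nonneg(1) n(1) by blast
    show "0 \<le> snd w + int n * e2"
      using ge pos2 nonneg(2) n(2) by blast
    have "fst w + int n * e1 + (snd w + int n * e2) = (fst w + snd w) + int n * (e1 + e2)"
      by (simp add: algebra_simps)
    also have "\<dots> = int \<alpha> * (j + int n * int (card \<sigma>))"
      unfolding sum deg by (simp add: algebra_simps)
    finally show "fst w + int n * e1 + (snd w + int n * e2) = int \<alpha> * (j + int n * int (card \<sigma>))" .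
    have "1 \<le> int (card \<sigma>)"
      using \<sigma>(2) fin by (simp add: Suc_le_eq card_gt_0_iff)
    then have "int n * 1 \<le> int n * int (card \<sigma>)"
      by (intro mult_left_mono) auto
    then show "int N \<le> j + int n * int (card \<sigma>)"
      using n(3) by linarith
  qed
  then show ?thesis
    unfolding loc_def exps_def e1_def e2_def by (intro CollectI exI[of _ n]) simp
qed

section \<open>Upper bound: vanishing of local cohomology beyond \<open>N\<close>\<close>

text \<open>
  In degree \<open>w\<close>, the Cech complex is the cochain complex of the family of all \<open>\<sigma>\<close> with
  \<open>w \<in> loc \<sigma>\<close>. It is contracted towards the vertex \<open>0\<close> or \<open>\<alpha>\<close>, depending on the sign of \<open>fst w\<close>.
\<close>
lemma cocycle_vanishing:
  assumes j: "int N < j"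
    and z: "z \<in> carrier (cech_cocycles (R :: 'k::field laurent ring) A (generator \<alpha>) i)"
    and hom: "\<And>\<sigma>. homogeneous \<alpha> (j - int i) (z \<sigma>)"
  shows "z \<in> cech_coboundaries R A (generator \<alpha>) i"
proof -
  have zC: "z \<in> cech_cochains R A (generator \<alpha>) i" and dz: "cech_diff A z = (\<lambda>_. 0)"
    using z by (simp_all add: cech_cocycles_def)
  have zI: "\<sigma> \<subseteq> A \<and> card \<sigma> = i \<and> w \<in> loc \<sigma> \<and> fst w + snd w = int \<alpha> * (j - int i)"
    if "w \<in> Poly_Mapping.keys (z \<sigma>)" for w \<sigma>
    using zC[unfolded cech_cochains_iff, THEN spec, of \<sigma>] that hom[of \<sigma>]
    by (auto simp: homogeneous_def split: if_splits)
  show ?thesis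
  proof (cases "i = 0")
    case True
    have "z \<sigma> = 0" for \<sigma>
    proof (cases "\<sigma> = {}")
      case True
      \<comment> \<open>The map from the component at \<open>{}\<close> to the one at
        \<open>{0}\<close> is injective, so there is no cohomology in cohomological degree
        0.\<close>
      have "cech_diff A z {0} = z {}"
        using zero_in by (simp add: cech_diff_def)
      then show ?thesis using True dz by simp
    next
      case False
      then have "\<not> (\<sigma> \<subseteq> A \<and> card \<sigma> = i)"
        using \<open>i = 0\<close> finite_A by (auto dest: finite_subset)
      then show ?thesis
        using zC[unfolded cech_cochains_iff, THEN spec, of \<sigma>] by presburger
    qed
    then show ?thesis
      using True by (auto simp: cech_coboundaries_def)
  next
    case False
    define a where "a w = (if fst w < 0 then 0 else \<alpha>)" for w :: "int \<times> int"
    have aA: "a w \<in> A" for w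
      using zero_in high(3) by (simp add: a_def)
    define F where "F w \<sigma> = Poly_Mapping.lookup (z \<sigma>) w" for w \<sigma>
    \<comment> \<open>The apex varies with the exponent, so the homotopy is assembled coefficient by
      coefficient. Supports stay finite because only two apices occur.\<close>
    define y where "y \<sigma> = Abs_poly_mapping (\<lambda>w. cech_contract (a w) (F w) \<sigma>)" for \<sigma>
    have nz: "a w \<notin> \<sigma> \<and> w \<in> Poly_Mapping.keys (z (insert (a w) \<sigma>))"
      if "cech_contract (a w) (F w) \<sigma> \<noteq> 0" for w \<sigma>
      using that by (auto simp: cech_contract_def F_def in_keys_iff split: if_splits)
    have "finite {w. cech_contract (a w) (F w) \<sigma> \<noteq> 0}" for \<sigma>
    proof (rule finite_subset)
      show "{w. cech_contract (a w) (F w) \<sigma> \<noteq> 0} \<subseteq>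
          Poly_Mapping.keys (z (insert 0 \<sigma>)) \<union> Poly_Mapping.keys (z (insert \<alpha> \<sigma>))"
        using nz by (fastforce simp: a_def split: if_splits)
    qed simp
    then have y: "Poly_Mapping.lookup (y \<sigma>) w = cech_contract (a w) (F w) \<sigma>" for \<sigma> w
      by (simp add: y_def)
    have "y \<in> cech_cochains R A (generator \<alpha>) (i - 1)"
      unfolding cech_cochains_iff
    proof
      fix \<sigma>
      have key: "\<sigma> \<subseteq> A \<and> card \<sigma> = i - 1 \<and> w \<in> loc \<sigma>" if "w \<in> Poly_Mapping.keys (y \<sigma>)" for w
      proof -
        have a: "a w \<notin> \<sigma>" and w: "w \<in> Poly_Mapping.keys (z (insert (a w) \<sigma>))"
          using that nz[of w \<sigma>] by (auto simp: in_keys_iff y)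
        note * = zI[OF w]
        then have \<sigma>: "\<sigma> \<subseteq> A" and fin: "finite \<sigma>"
          using finite_A by (auto dest: finite_subset)
        have card: "card \<sigma> = i - 1"
          using * a fin by auto
        have "w \<in> loc \<sigma>"
        \<comment> \<open>For \<open>i = 1\<close> the contraction lands in the component at
          \<open>{}\<close>, where holes matter. There both coordinates of \<open>w\<close> are
          nonnegative, and the degree \<open>j - 1\<close> is at least \<open>N\<close>, beyond all
          holes.\<close>
        proof (cases "i = 1")
          case True
          then have empty: "\<sigma> = {}"
            using card fin by simp
          with * have "w \<in> loc {a w}" by simp
          then have "0 \<le> fst w" "0 \<le> snd w"
            using loc_zero[of w] loc_alpha[of w] by (auto simp: a_def split: if_splits)
          moreover have "int N \<le> j - int i"
            using j True by simp
          ultimately have "(fst w, snd w) \<in> T"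
            using * by (intro T_full[of _ _ "j - int i"]) auto
          then show ?thesis
            by (simp add: empty loc_empty)
        next
          case i: False
          then have ne: "\<sigma> \<noteq> {}"
            using card \<open>i \<noteq> 0\<close> by auto
          show ?thesis
          proof (rule locI[OF \<sigma> ne])
            show "fst w + snd w = int \<alpha> * (j - int i)"
              using * by blast
            show "0 \<le> fst w \<or> (\<exists>a\<in>\<sigma>. a \<noteq> 0)"
              using a ne by (auto simp: a_def)
            show "0 \<le> snd w \<or> (\<exists>a\<in>\<sigma>. a \<noteq> \<alpha>)"
            proof (cases "0 \<le> fst w \<or> 0 \<le> snd w")
              case True
              then show ?thesis
                using a ne by (auto simp: a_def)
            next
              case False
              \<comment> \<open>With both coordinates negative the degree is negative, so
                \<open>card \<sigma> = i - 1 \<ge> j > N \<ge> 1\<close>. Two elements suffice for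
                one different from \<alpha>.\<close>
              then have "int \<alpha> * (j - int i) < 0"
                using * by linarith
              then have "j < int i"
                by (simp add: mult_less_0_iff)
              then have "2 \<le> card \<sigma>"
                using card j N_pos by linarith
              then have "\<not> \<sigma> \<subseteq> {\<alpha>}"
                using card_mono[of "{\<alpha>}" \<sigma>] by auto
              then show ?thesis by blast
            qed
          qed
        qed
        with \<sigma> card show ?thesis by blast
      qed
      show "if \<sigma> \<subseteq> A \<and> card \<sigma> = i - 1 then Poly_Mapping.keys (y \<sigma>) \<subseteq> loc \<sigma> else y \<sigma> = 0"
      proof (cases "\<sigma> \<subseteq> A \<and> card \<sigma> = i - 1")
        case True
        then show ?thesis using key by auto
      next
        case False
        then have "Poly_Mapping.keys (y \<sigma>) = {}"
          using key by blast
        then show ?thesis using False by auto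
      qed
    qed
    moreover have "cech_diff A y = z"
    proof (rule ext, rule poly_mapping_eqI)
      fix \<sigma> w
      have "cech_diff A (cech_contract (a w) (F w)) = F w"
      proof (rule cech_diff_contract[OF finite_A aA])
        show "F w \<tau> = 0" if "\<not> \<tau> \<subseteq> A" for \<tau>
          using zC[unfolded cech_cochains_iff, THEN spec, of \<tau>] that by (simp add: F_def)
        show "cech_diff A (F w) = (\<lambda>_. 0)"
          using dz lookup_cech_diff[of A z _ w] unfolding F_def by (auto simp: fun_eq_iff)
      qed
      then show "Poly_Mapping.lookup (cech_diff A y \<sigma>) w = Poly_Mapping.lookup (z \<sigma>) w"
        by (simp add: lookup_cech_diff y F_def)
    qed
    ultimately show ?thesis
      using False by (auto simp: cech_coboundaries_def)
  qed
qed

section \<open>Lower bound: nonzero classes in cohomological degrees 1 and 2\<close>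

text \<open>
  If \<open>w \<notin> loc \<rho>\<close>, then the cochain \<open>t\<^sup>w\<close> on \<open>\<rho>\<close> does not belong to the Cech complex, so that its
  coboundary may represent a nonzero class.
\<close>
lemma single_coboundary:
  fixes w \<rho> defines "z \<equiv> cech_diff A (\<lambda>\<sigma>. if \<sigma> = \<rho> then Poly_Mapping.single w 1 else 0)"
  assumes loc: "\<And>\<tau>. \<tau> \<subseteq> A \<Longrightarrow> card \<tau> = Suc (card \<rho>) \<Longrightarrow> w \<in> loc \<tau>"
    and deg: "fst w + snd w = int \<alpha> * j"
  shows "z \<in> carrier (cech_cocycles (R :: 'k::field laurent ring) A (generator \<alpha>) (Suc (card \<rho>)))"
    and "homogeneous \<alpha> j (z \<sigma>)"
proof -
  have keys: "u = w \<and> \<tau> \<subseteq> A \<and> card \<tau> = Suc (card \<rho>)" if u: "u \<in> Poly_Mapping.keys (z \<tau>)" for u \<tau>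
  proof -
    have "\<tau> \<subseteq> A \<and> (\<exists>a\<in>\<tau>. \<tau> - {a} = \<rho> \<and> u = w)"
    proof (rule ccontr)
      assume "\<not> (\<tau> \<subseteq> A \<and> (\<exists>a\<in>\<tau>. \<tau> - {a} = \<rho> \<and> u = w))"
      then have "Poly_Mapping.lookup (z \<tau>) u = 0"
        unfolding z_def lookup_cech_diff unfolding cech_diff_def
        by (auto simp: lookup_single when_def intro!: sum.neutral)
      with u show False
        by (simp add: in_keys_iff)
    qed
    moreover from this have "finite \<tau>"
      using finite_A finite_subset by blast
    ultimately show ?thesis
      by (metis card_Suc_Diff1)
  qed
  have "z \<in> cech_cochains (R :: 'k laurent ring) A (generator \<alpha>) (Suc (card \<rho>))"
    unfolding cech_cochains_iff
  proof
    fix \<tau>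
    show "if \<tau> \<subseteq> A \<and> card \<tau> = Suc (card \<rho>) then Poly_Mapping.keys (z \<tau>) \<subseteq> loc \<tau> else z \<tau> = 0"
    proof (cases "\<tau> \<subseteq> A \<and> card \<tau> = Suc (card \<rho>)")
      case True
      then show ?thesis using keys loc by auto
    next
      case False
      then have "Poly_Mapping.keys (z \<tau>) = {}"
        using keys by blast
      then show ?thesis using False by auto
    qed
  qed
  then show "z \<in> carrier (cech_cocycles R A (generator \<alpha>) (Suc (card \<rho>)))"
    by (simp add: cech_cocycles_def z_def cech_diff_diff[OF finite_A])
  show "homogeneous \<alpha> j (z \<sigma>)"
    using keys deg by (auto simp: homogeneous_def)
qed

text \<open>A hole of degree \<open>N - 1\<close> has nonnegative coordinates, so it lies in
  \<open>loc {a}\<close> for every \<open>a \<in> A\<close>, but not in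
  \<open>loc {} = T\<close>.\<close>

lemma piece_nontrivial_H1:
  assumes "1 < N"
  shows "local_cohomology_piece \<alpha> A R 1 (int N - 1) \<noteq>
    {\<one>\<^bsub>local_cohomology (R :: 'k::field laurent ring) A (generator \<alpha>) 1\<^esub>}"
proof
  assume triv: "local_cohomology_piece \<alpha> A R 1 (int N - 1) =
    {\<one>\<^bsub>local_cohomology (R :: 'k laurent ring) A (generator \<alpha>) 1\<^esub>}"
  obtain x where x: "x \<le> (N - 1) * \<alpha>" "x \<notin> sumset A (N - 1)"
    using hole[OF assms] by blast
  define w where "w = (int x, int ((N - 1) * \<alpha>) - int x)"
  define z :: "nat set \<Rightarrow> 'k laurent" where
    "z = cech_diff A (\<lambda>\<sigma>. if \<sigma> = {} then Poly_Mapping.single w 1 else 0)"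
  have nonneg: "0 \<le> fst w" "0 \<le> snd w"
    using x(1) by (simp_all add: w_def del: of_nat_mult)
  have deg: "fst w + snd w = int \<alpha> * (int N - 1)"
    using assms by (simp add: w_def of_nat_diff mult.commute)
  have loc: "w \<in> loc \<tau>" if "\<tau> \<subseteq> A" "card \<tau> = Suc (card ({} :: nat set))" for \<tau>
    using that nonneg by (intro locI[OF _ _ deg]) auto
  have "z \<in> carrier (cech_cocycles R A (generator \<alpha>) 1)" "\<And>\<sigma>. homogeneous \<alpha> (int N - 1) (z \<sigma>)"
    using single_coboundary[of "{}" w, OF loc deg, where ?'k = 'k] by (simp_all add: z_def)
  then have "z \<in> cech_coboundaries R A (generator \<alpha>) 1"
    using triv unfolding piece_trivial_iff by blast
  then obtain c where c: "c \<in> cech_cochains (R :: 'k laurent ring) A (generator \<alpha>) 0" "z = cech_diff A c"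
    by (auto simp: cech_coboundaries_def)
  \<comment> \<open>The component at \<open>{0}\<close> recovers the value at \<open>{}\<close>, so
    a bounding cochain would have to contain the hole as an exponent.\<close>
  have "cech_diff A c {0} = c {}" "z {0} = Poly_Mapping.single w 1"
    using zero_in by (simp_all add: z_def cech_diff_def)
  then have "w \<in> Poly_Mapping.keys (c {})"
    using c(2) by simp
  then have "w \<in> T"
    using c(1)[unfolded cech_cochains_iff, THEN spec, of "{}"] by (auto simp: loc_empty)
  then show False
    using x(2) by (simp only: w_def T_degree_iff)
qed

text \<open>Supplies the lower bound 1 = -1 + 2 for the case \<open>N = 1\<close>. The point
  \<open>w\<close> has degree -1 and two negative coordinates: it lies in \<open>loc \<tau>\<close>
  for each pair \<open>\<tau> \<subseteq> A\<close>, but in neither \<open>loc {0}\<close> nor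
  \<open>loc {\<alpha>}\<close>.\<close>

lemma piece_nontrivial_H2:
  "local_cohomology_piece \<alpha> A R 2 (- 1) \<noteq>
    {\<one>\<^bsub>local_cohomology (R :: 'k::field laurent ring) A (generator \<alpha>) 2\<^esub>}"
proof
  assume triv: "local_cohomology_piece \<alpha> A R 2 (- 1) =
    {\<one>\<^bsub>local_cohomology (R :: 'k laurent ring) A (generator \<alpha>) 2\<^esub>}"
  define w where "w = (- 1 :: int, 1 - int \<alpha>)"
  define z :: "nat set \<Rightarrow> 'k laurent" where
    "z = cech_diff A (\<lambda>\<sigma>. if \<sigma> = {0} then Poly_Mapping.single w 1 else 0)"
  have deg: "fst w + snd w = int \<alpha> * - 1"
    by (simp add: w_def)
  have loc: "w \<in> loc \<tau>" if \<tau>: "\<tau> \<subseteq> A" "card \<tau> = Suc (card {0 :: nat})" for \<tau>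
  proof (rule locI[OF \<tau>(1) _ deg])
    have "\<not> \<tau> \<subseteq> {b}" for b
      using \<tau>(2) card_mono[of "{b}" \<tau>] by auto
    then show "\<tau> \<noteq> {}" "0 \<le> fst w \<or> (\<exists>a\<in>\<tau>. a \<noteq> 0)" "0 \<le> snd w \<or> (\<exists>a\<in>\<tau>. a \<noteq> \<alpha>)"
      by blast+
  qed
  have "z \<in> carrier (cech_cocycles R A (generator \<alpha>) 2)" "\<And>\<sigma>. homogeneous \<alpha> (- 1) (z \<sigma>)"
    using single_coboundary[of "{0}" w, OF loc deg, where ?'k = 'k]
    by (simp_all add: z_def numeral_2_eq_2)
  then have "z \<in> cech_coboundaries R A (generator \<alpha>) 2"
    using triv unfolding piece_trivial_iff by blast
  then obtain c where c: "c \<in> cech_cochains (R :: 'k laurent ring) A (generator \<alpha>) 1" "z = cech_diff A c"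
    by (auto simp: cech_coboundaries_def)
  \<comment> \<open>The component at \<open>{0, \<alpha>}\<close> is tested because it involves only
    the two vertices whose localizations miss \<open>w\<close>.\<close>
  have diff: "cech_diff A d {0, \<alpha>} = d {\<alpha>} - d {0}" for d :: "nat set \<Rightarrow> 'k laurent"
  proof -
    have "{b. (b = 0 \<or> b = \<alpha>) \<and> b < \<alpha>} = {0}" "{0, \<alpha>} - {0} = {\<alpha>}" "{0, \<alpha>} - {\<alpha>} = {0}"
      using q_less by auto
    then show ?thesis
      using zero_in high(3) q_less by (simp add: cech_diff_def)
  qed
  have "w \<notin> loc {0}" "w \<notin> loc {\<alpha>}"
    using loc_zero[of w] loc_alpha[of w] p_pos p_less q_less by (auto simp: w_def)
  then have "w \<notin> Poly_Mapping.keys (c {0})" "w \<notin> Poly_Mapping.keys (c {\<alpha>})"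
    using c(1)[unfolded cech_cochains_iff, THEN spec, of "{0}"]
      c(1)[unfolded cech_cochains_iff, THEN spec, of "{\<alpha>}"] by (auto split: if_splits)
  then have "Poly_Mapping.lookup (z {0, \<alpha>}) w = 0"
    unfolding c(2) diff by (simp add: lookup_minus in_keys_iff)
  moreover have "z {0, \<alpha>} = - Poly_Mapping.single w 1"
    unfolding z_def diff using q_less by simp
  ultimately show False
    by simp
qed

lemma regularity_eq: "regularity \<alpha> A (R :: 'k::field laurent ring) = int N"
  unfolding regularity_def
proof (rule Least_equality)
  show "\<forall>i j. int N < j \<longrightarrow> local_cohomology_piece \<alpha> A (R :: 'k laurent ring) i (j - int i) =
      {\<one>\<^bsub>local_cohomology (R :: 'k laurent ring) A (generator \<alpha>) i\<^esub>}"
    unfolding piece_trivial_iff using cocycle_vanishing by blast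
next
  fix n
  assume n: "\<forall>i j. n < j \<longrightarrow> local_cohomology_piece \<alpha> A (R :: 'k laurent ring) i (j - int i) =
      {\<one>\<^bsub>local_cohomology (R :: 'k laurent ring) A (generator \<alpha>) i\<^esub>}"
  show "int N \<le> n"
  proof (rule ccontr)
    assume "\<not> int N \<le> n"
    then have *: "local_cohomology_piece \<alpha> A (R :: 'k laurent ring) i (int N - int i) =
        {\<one>\<^bsub>local_cohomology (R :: 'k laurent ring) A (generator \<alpha>) i\<^esub>}" for i
      using n by simp
    show False
    \<comment> \<open>At \<open>j = N\<close> the nonzero class comes from a hole of degree
      \<open>N - 1\<close> in the first case, and from degree \<open>N - 2 = -1\<close> of the
      second cohomology if \<open>N = 1\<close>.\<close>
    proof (cases "1 < N")
      case True
      then show False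
        using *[of 1] piece_nontrivial_H1[where ?'k = 'k] by simp
    next
      case False
      then have "N = 1"
        using N_pos by simp
      then show False
        using *[of 2] piece_nontrivial_H2[where ?'k = 'k] by simp
    qed
  qed
qed

end

theorem theorem3p6:
  fixes \<alpha> p l :: nat and q :: "nat \<Rightarrow> nat" and A :: "nat set"
    and R :: "'k::field laurent ring"
  assumes "0 < \<alpha>" "0 < p" "0 < l"
    and "strict_mono_on {1..l} q" "p < q 1" "q l = \<alpha> - 1"
    and "\<alpha> - q 1 \<le> p"
    and "A = {0..p} \<union> q ` {1..l} \<union> {\<alpha>}"
    and "R = semigroup_ring (assoc_semigroup \<alpha> A)"
  shows "int (reduction_number \<alpha> R) = regularity \<alpha> A R"
proof -
  \<comment> \<open>Places every \<open>q i\<close> between \<open>q 1\<close> and \<alpha> - 1,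
    which gives \<open>A\<close> the shape that \<open>gap_set\<close> asks for.\<close>
  have q: "q 1 \<le> q i \<and> q i \<le> q l" if "i \<in> {1..l}" for i
    using strict_mono_on_leD[OF assms(4), of 1 i] strict_mono_on_leD[OF assms(4), of i l] that
    by auto
  interpret gap_set \<alpha> p "q 1" A
  proof
    show "q 1 < \<alpha>"
      using q[of 1] assms(1,3,6) by simp
    show "q 1 \<in> A"
      using assms(3,8) by simp
    have "q l \<in> A"
      using assms(3,8) by simp
    then show "\<alpha> - 1 \<in> A"
      by (simp only: assms(6))
    show "A \<subseteq> {0..p} \<union> {q 1..\<alpha>}"
      using q assms(6,8) \<open>q 1 < \<alpha>\<close> by fastforce
  qed (use assms in auto)
  show ?thesis
    unfolding assms(9) by (simp only: reduction_number_eq[OF refl] regularity_eq)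
qed

end
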